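(* Let $\mathcal{A}$ be a Banach algebra such that $\mathrm{rad}(\mathcal{A})=\mathrm{rann}(\mathcal{A})$ and $\mathcal{A}/\mathrm{rad}(\mathcal{A})$ is commutative, and suppose $\mathcal{A}$ has a right identity. Then the algebra $\mathfrak{C}(\mathcal{A})$ of all centralizing generalized derivations of $\mathcal{A}$ (with composition as product) is isomorphic to $\mathcal{A}/\mathrm{rad}(\mathcal{A})$.
   Context: $\mathrm{rad}(\mathcal{A})$ is the Jacobson radical and $\mathrm{rann}(\mathcal{A})=\{c\in\mathcal{A}: ac=0\ \forall a\in\mathcal{A}\}$. A derivation is a linear map $d$ with $d(ab)=d(a)b+ad(b)$; a generalized derivation is a linear $\delta$ for which there is a derivation $d$ with $\delta(ab)=a\delta(b)+d(a)b$. It is centralizing if $[\delta(a),a]\in Z(\mathcal{A})$ for all $a$, where $Z(\mathcal{A})$ is the center and $[x,y]=xy-yx$. $\mathfrak{C}(\mathcal{A})$ is regarded as a subalgebra of the algebra of bounded linear operators on $\mathcal{A}$. *)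

theory Defs
  imports "HOL-Analysis.Analysis"
begin

text \<open>A complex Banach algebra: a real Banach algebra (type class
  real_normed_algebra + banach; no unit is assumed) together with a complex
  scalar multiplication sm extending scaleR and compatible with the
  ring structure and the norm.\<close>

definition complex_banach_algebra :: "(complex \<Rightarrow> 'a::{real_normed_algebra,banach} \<Rightarrow> 'a) \<Rightarrow> bool" where
  "complex_banach_algebra sm \<longleftrightarrow>
     (\<forall>r x. sm (complex_of_real r) x = scaleR r x) \<and>
     (\<forall>c x y. sm c (x + y) = sm c x + sm c y) \<and>
     (\<forall>c d x. sm (c + d) x = sm c x + sm d x) \<and>
     (\<forall>c d x. sm (c * d) x = sm c (sm d x)) \<and>
     (\<forall>c x y. sm c (x * y) = sm c x * y) \<and>
     (\<forall>c x y. sm c (x * y) = x * sm c y) \<and>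
     (\<forall>c x. norm (sm c x) = cmod c * norm x)"

definition clinear_map :: "(complex \<Rightarrow> 'a::{real_normed_algebra,banach} \<Rightarrow> 'a) \<Rightarrow> ('a \<Rightarrow> 'a) \<Rightarrow> bool" where
  "clinear_map sm f \<longleftrightarrow> (\<forall>x y. f (x + y) = f x + f y) \<and> (\<forall>c x. f (sm c x) = sm c (f x))"

definition quasi_invertible :: "'a::ring \<Rightarrow> bool" where
  "quasi_invertible x \<longleftrightarrow> (\<exists>y. x + y - x * y = 0 \<and> y + x - y * x = 0)"

text \<open>Jacobson radical (valid also for non-unital algebras).\<close>
definition jrad :: "'a::ring set" where
  "jrad = {x. \<forall>a. quasi_invertible (a * x)}"

definition rann :: "'a::ring set" where
  "rann = {c. \<forall>a. a * c = 0}"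

definition center :: "'a::ring set" where
  "center = {z. \<forall>a. z * a = a * z}"

definition derivation :: "(complex \<Rightarrow> 'a::{real_normed_algebra,banach} \<Rightarrow> 'a) \<Rightarrow> ('a \<Rightarrow> 'a) \<Rightarrow> bool" where
  "derivation sm d \<longleftrightarrow> clinear_map sm d \<and> (\<forall>a b. d (a * b) = d a * b + a * d b)"

definition generalized_derivation :: "(complex \<Rightarrow> 'a::{real_normed_algebra,banach} \<Rightarrow> 'a) \<Rightarrow> ('a \<Rightarrow> 'a) \<Rightarrow> bool" where
  "generalized_derivation sm \<delta> \<longleftrightarrow> clinear_map sm \<delta> \<and>
     (\<exists>d. derivation sm d \<and> (\<forall>a b. \<delta> (a * b) = a * \<delta> b + d a * b))"

definition centralizing :: "('a::ring \<Rightarrow> 'a) \<Rightarrow> bool" where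
  "centralizing \<delta> \<longleftrightarrow> (\<forall>a. \<delta> a * a - a * \<delta> a \<in> center)"

definition CGD :: "(complex \<Rightarrow> 'a::{real_normed_algebra,banach} \<Rightarrow> 'a) \<Rightarrow> ('a \<Rightarrow> 'a) set" where
  "CGD sm = {\<delta>. generalized_derivation sm \<delta> \<and> centralizing \<delta>}"

definition rcoset :: "'a::ring \<Rightarrow> 'a set" where
  "rcoset x = {x + r | r. r \<in> jrad}"

text \<open>C(A) is a complex algebra under pointwise operations and composition,
  and it is isomorphic (as complex algebra) to A / rad(A) with the operations
  (x+R)+(y+R) = (x+y)+R, c(x+R) = cx+R, (x+R)(y+R) = xy+R.\<close>
definition CGD_iso_quotient :: "(complex \<Rightarrow> 'a::{real_normed_algebra,banach} \<Rightarrow> 'a) \<Rightarrow> bool" where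
  "CGD_iso_quotient sm \<longleftrightarrow>
     (\<forall>\<delta>\<in>CGD sm. \<forall>\<gamma>\<in>CGD sm. \<forall>c.
        (\<lambda>z. \<delta> z + \<gamma> z) \<in> CGD sm \<and> (\<lambda>z. sm c (\<delta> z)) \<in> CGD sm \<and> \<delta> \<circ> \<gamma> \<in> CGD sm) \<and>
     (\<exists>\<Phi>. bij_betw \<Phi> (CGD sm) (range rcoset) \<and>
        (\<forall>\<delta>\<in>CGD sm. \<forall>\<gamma>\<in>CGD sm. \<forall>x y c. \<Phi> \<delta> = rcoset x \<longrightarrow> \<Phi> \<gamma> = rcoset y \<longrightarrow>
            \<Phi> (\<lambda>z. \<delta> z + \<gamma> z) = rcoset (x + y) \<and>
            \<Phi> (\<lambda>z. sm c (\<delta> z)) = rcoset (sm c x) \<and>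
            \<Phi> (\<delta> \<circ> \<gamma>) = rcoset (x * y)))"

end

theory Submission
  imports Defs
begin

text \<open>
  Let \<open>e\<close> be a right identity and \<open>R\<close> the radical. A generalized derivation has the form
  \<open>\<delta> a = a \<cdot> \<delta> e + d a\<close>. Commutators lie in \<open>R\<close>, which meets the center trivially, so a centralizing
  \<open>\<delta>\<close> satisfies \<open>\<delta> a \<cdot> a = a \<cdot> \<delta> a\<close>; this forces \<open>d a = e \<cdot> d a\<close>. Hence \<open>d\<close> is determined by the
  derivation it induces on the commutative semisimple algebra \<open>A / R\<close>, which vanishes by the
  theorems of Johnson and of Singer and Wermer. So the centralizing generalized derivations are the
  right multiplications, and right multiplication by \<open>x\<close> depends exactly on \<open>x + R\<close>.

  Johnson: only finitely many characters \<open>\<phi>\<close> have \<open>\<phi> \<circ> d\<close> discontinuous. Otherwise take a sequence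
  \<open>\<phi>\<^sub>n\<close> of such characters, an \<open>x\<close> at which they take different values, and \<open>b\<^sub>n\<close> proportional to
  \<open>x - \<phi>\<^sub>n x \<cdot> e\<close>; then \<open>z \<mapsto> \<phi>\<^sub>n (d (b\<^sub>0 \<cdots> b\<^sub>j\<^sub>-\<^sub>1 z))\<close> is discontinuous for \<open>j = n\<close> and
  continuous for \<open>j = n + 1\<close>, which a gliding hump excludes. A limit \<open>y\<close> of \<open>d x\<^sub>n\<close> with \<open>x\<^sub>n \<rightarrow> 0\<close> is
  killed by all the other characters; if one of the exceptional \<open>\<phi>\<close> did not kill \<open>y\<close>, it would be
  isolated in the character space and then \<open>\<phi> \<circ> d = 0\<close>. By semisimplicity \<open>y = 0\<close>, so \<open>d\<close> is
  continuous by the closed graph theorem.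

  Singer--Wermer: \<open>x \<mapsto> \<Sum>\<^sub>n \<phi> (d\<^sup>n x) t\<^sup>n / n!\<close> is a homomorphism into the formal power series. So if
  \<open>\<phi> a = 0\<close>, then \<open>\<phi> (d\<^sup>n (a\<^sup>n)) = n! (\<phi> (d a))\<^sup>n\<close>, and the left-hand side grows at most
  geometrically, whence \<open>\<phi> (d a) = 0\<close>.
\<close>

section \<open>Consequences of the Baire category theorem\<close>

lemma Baire_countable_cover:
  fixes V :: "nat \<Rightarrow> 'a::complete_space set"
  assumes "\<And>n. closed (V n)" and "(\<Union>n. V n) = UNIV"
  shows "\<exists>n. interior (V n) \<noteq> {}"
proof (rule ccontr)
  assume "\<not> ?thesis"
  then have "Met_TC.mtopology interior_of \<Union>(range V) = {}"
    using assms(1) by (intro Met_TC.metric_Baire_category_alt) (auto simp: complete_UNIV)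
  then show False
    using assms(2) by simp
qed

lemma interior_kernel_eq_empty:
  fixes f :: "'a::real_normed_vector \<Rightarrow> 'b::real_vector"
  assumes "linear f" and "f v \<noteq> 0"
  shows "interior {x. f x = 0} = {}"
proof (rule ccontr)
  assume "\<not> ?thesis"
  then obtain x \<epsilon> where "\<epsilon> > 0" and ball: "ball x \<epsilon> \<subseteq> {x. f x = 0}"
    using mem_interior by blast
  define t where "t = \<epsilon> / (1 + norm v)"
  have "1 + norm v > 0"
    by (simp add: add_pos_nonneg)
  then have "t > 0" "norm (t *\<^sub>R v) < \<epsilon>"
    using \<open>\<epsilon> > 0\<close> by (simp_all add: t_def field_simps)
  then have "x \<in> ball x \<epsilon>" "x + t *\<^sub>R v \<in> ball x \<epsilon>"
    using \<open>\<epsilon> > 0\<close> by (simp_all add: dist_norm)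
  then have "f x = 0" "f (x + t *\<^sub>R v) = 0"
    using ball by blast+
  then show False
    using assms \<open>t > 0\<close> by (simp add: linear_add linear_scale)
qed

lemma countable_functionals_common_nonzero:
  fixes f :: "'i \<Rightarrow> 'a::banach \<Rightarrow> 'b::real_normed_vector"
  assumes "countable I" and f: "\<And>i. i \<in> I \<Longrightarrow> bounded_linear (f i)"
    and nonzero: "\<And>i. i \<in> I \<Longrightarrow> \<exists>v. f i v \<noteq> 0"
  shows "\<exists>x. \<forall>i\<in>I. f i x \<noteq> 0"
proof (cases "I = {}")
  case False
  show ?thesis
  proof (rule ccontr)
    assume none: "\<not> ?thesis"
    define g where "g n = f (from_nat_into I n)" for n
    have g: "bounded_linear (g n)" "\<exists>v. g n v \<noteq> 0" for n
      unfolding g_def using from_nat_into[OF False] f nonzero by blast+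
    have "(\<Union>n. {x. g n x = 0}) = UNIV"
      using none from_nat_into_surj[OF \<open>countable I\<close>] unfolding g_def by blast
    moreover have "closed {x. g n x = 0}" for n
      by (intro closed_Collect_eq continuous_intros linear_continuous_on g)
    ultimately obtain n where "interior {x. g n x = 0} \<noteq> {}"
      using Baire_countable_cover by metis
    then show False
      using interior_kernel_eq_empty g bounded_linear.linear by blast
  qed
qed simp

lemma ball_subset_closure_sublevel:
  fixes f :: "'a::complete_space \<Rightarrow> real"
  obtains z \<epsilon> n where "\<epsilon> > 0" and "ball z \<epsilon> \<subseteq> closure {x. f x \<le> real n}"
proof -
  define V where "V n = closure {x. f x \<le> real n}" for n
  have "x \<in> V (nat \<lceil>f x\<rceil>)" for x
    unfolding V_def by (rule closure_subset[THEN subsetD]) (simp add: real_nat_ceiling_ge)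
  then have "(\<Union>n. V n) = UNIV" by blast
  moreover have "closed (V n)" for n
    by (simp add: V_def)
  ultimately obtain n where "interior (V n) \<noteq> {}"
    using Baire_countable_cover by blast
  then show ?thesis
    using that unfolding V_def by (meson all_not_in_conv mem_interior)
qed

lemma linear_halving_step:
  fixes f :: "'a::banach \<Rightarrow> 'b::real_normed_vector"
  assumes "linear f"
  obtains K where "\<And>x. \<exists>y. norm y \<le> norm x / 2 \<and> norm (f (x - y)) \<le> K * norm x"
proof -
  obtain z \<epsilon> n where "\<epsilon> > 0" and ball: "ball z \<epsilon> \<subseteq> closure {x. norm (f x) \<le> real n}"
    using ball_subset_closure_sublevel[of "\<lambda>x. norm (f x)"] by metis
  have "\<exists>y. norm y \<le> norm x / 2 \<and> norm (f (x - y)) \<le> (4 * real n / \<epsilon>) * norm x" for x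
  proof (cases "x = 0")
    case False
    define t where "t = \<epsilon> / (2 * norm x)"
    have "t > 0" and tx: "t * norm x = \<epsilon> / 2"
      using False \<open>\<epsilon> > 0\<close> by (simp_all add: t_def)
    then have "z + t *\<^sub>R x \<in> ball z \<epsilon>" "z \<in> ball z \<epsilon>"
      using \<open>\<epsilon> > 0\<close> by (simp_all add: dist_norm)
    then obtain a b where a: "norm (f a) \<le> n" "dist a (z + t *\<^sub>R x) < \<epsilon> / 8"
      and b: "norm (f b) \<le> n" "dist b z < \<epsilon> / 8"
      using subsetD[OF ball] \<open>\<epsilon> > 0\<close> unfolding closure_approachable
      by (metis (mono_tags, lifting) mem_Collect_eq zero_less_divide_iff zero_less_numeral)
    define u where "u = (1 / t) *\<^sub>R (a - b)"
    have "t * norm (f u) = norm (f a - f b)"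
      using \<open>t > 0\<close> by (simp add: u_def linear_scale[OF assms] linear_diff[OF assms])
    also have "\<dots> \<le> (4 * real n / \<epsilon>) * (t * norm x)"
      using norm_triangle_ineq4[of "f a" "f b"] a b \<open>\<epsilon> > 0\<close> by (simp add: tx)
    also have "\<dots> = t * ((4 * real n / \<epsilon>) * norm x)" by simp
    finally have "norm (f u) \<le> (4 * real n / \<epsilon>) * norm x"
      using \<open>t > 0\<close> by (simp only: mult_le_cancel_left_pos)
    moreover have "t * norm (x - u) = norm (t *\<^sub>R (x - u))"
      using \<open>t > 0\<close> by simp
    then have "t * norm (x - u) = norm ((z + t *\<^sub>R x - a) + (b - z))"
      using \<open>t > 0\<close> by (simp add: u_def algebra_simps)
    then have "t * norm (x - u) \<le> t * (norm x / 2)"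
      using norm_triangle_ineq[of "z + t *\<^sub>R x - a" "b - z"] a b tx
      by (simp add: dist_norm norm_minus_commute)
    then have "norm (x - u) \<le> norm x / 2"
      using \<open>t > 0\<close> by simp
    ultimately show ?thesis
      by (intro exI[of _ "x - u"]) simp
  qed (auto intro: exI[of _ 0] simp: linear_0[OF assms])
  then show ?thesis
    using that by blast
qed

lemma norm_funpow_le:
  fixes f :: "'a::real_normed_vector \<Rightarrow> 'a"
  assumes "K \<ge> 0" and "\<And>x. norm (f x) \<le> K * norm x"
  shows "norm ((f ^^ n) x) \<le> K ^ n * norm x"
proof (induction n)
  case (Suc n)
  have "norm ((f ^^ Suc n) x) \<le> K * norm ((f ^^ n) x)"
    using assms(2) by simp
  also have "\<dots> \<le> K * (K ^ n * norm x)"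
    using Suc \<open>K \<ge> 0\<close> by (rule mult_left_mono)
  finally show ?case by (simp add: mult.assoc)
qed simp

lemma summable_increments_limit:
  fixes g :: "nat \<Rightarrow> 'a::banach"
  assumes increments: "\<And>k. norm (g k - g (Suc k)) \<le> b k" and "summable b"
  obtains l where "g \<longlonglongrightarrow> l" and "norm (g 0 - l) \<le> suminf b"
proof
  define y where "y = (\<Sum>k. g k - g (Suc k))"
  have "(\<lambda>N. g 0 - g N) \<longlonglongrightarrow> y"
    using summable_LIMSEQ[OF summable_comparison_test'[OF \<open>summable b\<close> increments]]
    unfolding sum_lessThan_telescope' y_def .
  from tendsto_diff[OF tendsto_const this, of "g 0"] show "g \<longlonglongrightarrow> g 0 - y"
    by simp
  show "norm (g 0 - (g 0 - y)) \<le> suminf b"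
    using norm_suminf_le[OF increments \<open>summable b\<close>] by (simp add: y_def)
qed

theorem closed_graph:
  fixes f :: "'a::banach \<Rightarrow> 'b::banach"
  assumes f: "linear f"
    and closed: "\<And>X y. X \<longlonglongrightarrow> 0 \<Longrightarrow> (\<lambda>n. f (X n)) \<longlonglongrightarrow> y \<Longrightarrow> y = 0"
  shows "bounded_linear f"
proof -
  obtain K where "\<And>x. \<exists>y. norm y \<le> norm x / 2 \<and> norm (f (x - y)) \<le> K * norm x"
    using linear_halving_step[OF f] by blast
  then obtain s where halve: "\<And>x. norm (s x) \<le> norm x / 2"
    and step: "\<And>x. norm (f (x - s x)) \<le> K * norm x"
    by metis
  have "norm (f x) \<le> norm x * (2 * \<bar>K\<bar>)" for x
  proof -
    define X where "X k = (s ^^ k) x" for k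
    have X: "norm (X k) \<le> (1 / 2) ^ k * norm x" for k
      unfolding X_def using halve by (intro norm_funpow_le) auto
    have increments: "norm (f (X k) - f (X (Suc k))) \<le> \<bar>K\<bar> * norm x * (1 / 2) ^ k" for k
    proof -
      have "norm (f (X k) - f (X (Suc k))) \<le> K * norm (X k)"
        using step[of "X k"] by (simp add: X_def linear_diff[OF f])
      also have "\<dots> \<le> \<bar>K\<bar> * ((1 / 2) ^ k * norm x)"
        using X by (intro mult_mono) auto
      finally show ?thesis by (simp add: mult_ac)
    qed
    have bound: "(\<lambda>k. \<bar>K\<bar> * norm x * (1 / 2) ^ k) sums (\<bar>K\<bar> * norm x * 2)"
      using geometric_sums[of "1 / 2 :: real"] by (intro sums_mult) simp
    obtain l where l: "(\<lambda>k. f (X k)) \<longlonglongrightarrow> l" and "norm (f (X 0) - l) \<le> \<bar>K\<bar> * norm x * 2"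
      using summable_increments_limit[OF increments sums_summable[OF bound]]
      unfolding sums_unique[OF bound, symmetric] by blast
    moreover have "(\<lambda>k. (1 / 2) ^ k * norm x) \<longlonglongrightarrow> 0"
      by (intro tendsto_mult_left_zero LIMSEQ_realpow_zero) auto
    then have "X \<longlonglongrightarrow> 0"
      by (rule Lim_null_comparison[rotated]) (simp add: X)
    then have "l = 0"
      using l by (rule closed)
    ultimately show ?thesis
      by (simp add: X_def mult_ac)
  qed
  then show ?thesis
    using f by (intro bounded_linear_intro) (auto simp: linear_add linear_scale)
qed

section \<open>A gliding hump\<close>

primrec compose_upto :: "(nat \<Rightarrow> 'a \<Rightarrow> 'a) \<Rightarrow> nat \<Rightarrow> 'a \<Rightarrow> 'a" where
  "compose_upto T 0 = id"
| "compose_upto T (Suc n) = compose_upto T n \<circ> T n"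

lemma linear_compose_upto: "(\<And>n. linear (T n)) \<Longrightarrow> linear (compose_upto T n)"
  by (induction n) (auto intro: linear_id linear_compose)

lemma compose_upto_expansion:
  fixes T :: "nat \<Rightarrow> 'a::real_vector \<Rightarrow> 'a"
  assumes "\<And>n. linear (T n)" and z: "\<And>n. z n = y n + T n (z (Suc n))"
  shows "z 0 = (\<Sum>j<n. compose_upto T j (y j)) + compose_upto T n (z n)"
proof (induction n)
  case (Suc n)
  have "compose_upto T n (z n) = compose_upto T n (y n) + compose_upto T (Suc n) (z (Suc n))"
    by (subst z) (simp add: linear_add[OF linear_compose_upto[OF assms(1)]])
  then show ?case
    using Suc by (simp add: add.assoc)
qed simp

lemma nested_series:
  fixes T :: "nat \<Rightarrow> 'a::banach \<Rightarrow> 'a"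
  assumes T: "\<And>n. bounded_linear (T n)" and T_le: "\<And>n x. norm (T n x) \<le> norm x"
    and y: "\<And>n. norm (y n) \<le> (1 / 2) ^ n"
  obtains z where "\<And>n. z n = y n + T n (z (Suc n))" and "\<And>n. norm (z n) \<le> 2 * (1 / 2) ^ n"
proof
  define u where "u = rec_nat y (\<lambda>_ v n. T n (v (Suc n)))"
  have u_0: "u 0 n = y n" and u_Suc: "u (Suc j) n = T n (u j (Suc n))" for j n
    by (simp_all add: u_def)
  have u_le: "norm (u j n) \<le> (1 / 2) ^ n * (1 / 2) ^ j" for j n
  proof (induction j arbitrary: n)
    case (Suc j)
    then show ?case
      using order_trans[OF T_le Suc[of "Suc n"]] by (simp add: u_Suc)
  qed (simp add: u_0 y)
  have geometric: "(\<lambda>j. (1 / 2) ^ n * (1 / 2 :: real) ^ j) sums (2 * (1 / 2) ^ n)" for n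
    using sums_mult[OF geometric_sums[of "1 / 2 :: real"], of "(1 / 2) ^ n"]
    by (simp add: mult.commute)
  have summable: "summable (\<lambda>j. u j n)" for n
    by (rule summable_comparison_test'[OF sums_summable[OF geometric] u_le])
  show "(\<Sum>j. u j n) = y n + T n (\<Sum>j. u j (Suc n))" for n
    using suminf_split_head[OF summable, of n]
      bounded_linear.suminf[OF T summable, of n "Suc n"] by (simp add: u_0 u_Suc)
  show "norm (\<Sum>j. u j n) \<le> 2 * (1 / 2) ^ n" for n
    unfolding sums_unique[OF geometric]
    by (rule norm_suminf_le[OF u_le sums_summable[OF geometric]])
qed

lemma unbounded_linear_large_value:
  fixes f :: "'a::real_normed_vector \<Rightarrow> 'b::real_normed_vector"
  assumes "linear f" and "\<not> bounded_linear f" and "\<epsilon> > 0"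
  shows "\<exists>x. norm x \<le> \<epsilon> \<and> B \<le> norm (f x)"
proof -
  have "\<not> (\<forall>v. norm (f v) \<le> norm v * (B / \<epsilon>))"
    using assms(1,2) bounded_linear_intro[of f "B / \<epsilon>"] by (metis linear_add linear_scale)
  then obtain v where v: "norm (f v) > norm v * (B / \<epsilon>)"
    by (auto simp: not_le)
  then have "v \<noteq> 0"
    using linear_0[OF assms(1)] by auto
  define x where "x = (\<epsilon> / norm v) *\<^sub>R v"
  have "norm (f x) = (\<epsilon> / norm v) * norm (f v)"
    using \<open>\<epsilon> > 0\<close> by (simp add: x_def linear_scale[OF assms(1)])
  also have "\<dots> \<ge> (\<epsilon> / norm v) * (norm v * (B / \<epsilon>))"
    using v \<open>\<epsilon> > 0\<close> by (intro mult_left_mono) auto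
  finally have "B \<le> norm (f x)"
    using \<open>v \<noteq> 0\<close> \<open>\<epsilon> > 0\<close> by simp
  moreover have "norm x \<le> \<epsilon>"
    using \<open>v \<noteq> 0\<close> \<open>\<epsilon> > 0\<close> by (simp add: x_def)
  ultimately show ?thesis by blast
qed

lemma norm_add3_ge:
  fixes u v w :: "'a::real_normed_vector"
  assumes "B + norm u + norm w \<le> norm v"
  shows "B \<le> norm (u + v + w)"
  using assms norm_triangle_ineq4[of "u + v + w" "u + w"] norm_triangle_ineq[of u w]
  by (simp add: algebra_simps)

lemma gliding_hump:
  fixes T :: "nat \<Rightarrow> 'a::banach \<Rightarrow> 'a" and f :: "nat \<Rightarrow> 'a \<Rightarrow> 'b::real_normed_vector"
  assumes T: "\<And>n. bounded_linear (T n)" and T_le: "\<And>n x. norm (T n x) \<le> norm x"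
    and f: "\<And>n. linear (f n)" and pointwise: "\<And>x. bounded (range (\<lambda>n. f n x))"
    and next_bounded: "\<And>n. bounded_linear (f n \<circ> compose_upto T (Suc n))"
  shows "\<exists>n. bounded_linear (f n \<circ> compose_upto T n)"
proof (rule ccontr)
  assume unbounded: "\<not> ?thesis"
  note T_linear = bounded_linear.linear[OF T]
  define P where "P = compose_upto T"
  obtain K where K: "\<And>n x. norm (f n (P (Suc n) x)) \<le> norm x * K n" and K_pos: "\<And>n. 0 < K n"
    using bounded_linear.pos_bounded[OF next_bounded] unfolding P_def comp_def by metis
  have "\<exists>y. norm y \<le> (1 / 2) ^ n \<and> n + norm (f n s) + K n \<le> norm (f n (P n y))" for n s
  proof -
    have "linear (f n \<circ> P n)" "\<not> bounded_linear (f n \<circ> P n)"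
      using unbounded unfolding P_def by (auto intro: linear_compose linear_compose_upto T_linear f)
    then show ?thesis
      using unbounded_linear_large_value[of "f n \<circ> P n" "(1 / 2) ^ n"] by simp
  qed
  then obtain Y where Y: "\<And>n s. norm (Y n s) \<le> (1 / 2) ^ n"
    and large: "\<And>n s. n + norm (f n s) + K n \<le> norm (f n (P n (Y n s)))"
    by metis
  define s where "s = rec_nat 0 (\<lambda>n s. s + P n (Y n s))"
  have s: "s n = (\<Sum>j<n. P j (Y j (s j)))" for n
    by (induction n) (simp_all add: s_def)
  obtain z where z: "\<And>n. z n = Y n (s n) + T n (z (Suc n))"
    and z_le: "\<And>n. norm (z n) \<le> 2 * (1 / 2) ^ n"
    using nested_series[of T "\<lambda>n. Y n (s n)", OF T T_le Y] by metis
  have "n \<le> norm (f n (z 0))" for n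
  proof -
    have "norm (z (Suc n)) \<le> 1"
      using z_le[of "Suc n"] power_le_one[of "1 / 2 :: real" n] by simp
    then have "norm (z (Suc n)) * K n \<le> 1 * K n"
      using K_pos[of n] by (intro mult_right_mono) simp_all
    then have "norm (f n (P (Suc n) (z (Suc n)))) \<le> K n"
      using order_trans[OF K] by simp
    then have "n \<le> norm (f n (s n) + f n (P n (Y n (s n))) + f n (P (Suc n) (z (Suc n))))"
      using large[of n "s n"] by (intro norm_add3_ge) simp
    moreover have "z 0 = s n + P n (Y n (s n)) + P (Suc n) (z (Suc n))"
      using compose_upto_expansion[of T z _ "Suc n", OF T_linear z] s[of n] by (simp add: P_def)
    ultimately show ?thesis
      by (simp add: linear_add[OF f])
  qed
  then show False
    using pointwise[of "z 0"] reals_Archimedean2 unfolding bounded_iff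
    by (metis not_le order_trans rangeI)
qed

section \<open>The Gelfand--Mazur theorem for seminormed algebras\<close>

lemma continuous_vanishing_at_infinity_attains_sup:
  fixes f :: "'a::{real_normed_vector,heine_borel} \<Rightarrow> real"
  assumes cont: "continuous_on UNIV f" and vanish: "(f \<longlongrightarrow> 0) at_infinity" and "f a > 0"
  shows "\<exists>z. \<forall>w. f w \<le> f z"
proof -
  have "\<forall>\<^sub>F w in at_infinity. f w < f a"
    using vanish \<open>f a > 0\<close> by (rule order_tendstoD)
  then obtain B where B: "\<And>w. norm w \<ge> B \<Longrightarrow> f w < f a"
    unfolding eventually_at_infinity by blast
  define C where "C = cball (0::'a) (max B (norm a))"
  have "a \<in> C" by (simp add: C_def)
  then obtain z where z: "\<And>w. w \<in> C \<Longrightarrow> f w \<le> f z"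
    using continuous_attains_sup[of C f] continuous_on_subset[OF cont]
    unfolding C_def by (metis compact_cball empty_iff subset_UNIV)
  have "f w \<le> f z" for w
  proof (cases "w \<in> C")
    case False
    then have "f w < f a" using B by (simp add: C_def)
    then show ?thesis using z[OF \<open>a \<in> C\<close>] by simp
  qed (rule z)
  then show ?thesis by blast
qed

lemma not_vanishing_at_infinity_if_maxima_stable:
  fixes f :: "'a::{real_normed_vector,heine_borel,perfect_space} \<Rightarrow> real"
  assumes cont: "continuous_on UNIV f" and "f a > 0"
    and stable: "\<And>z. \<forall>w. f w \<le> f z \<Longrightarrow> \<exists>\<delta>>0. \<forall>w\<in>ball z \<delta>. f w = f z"
  shows "\<not> (f \<longlongrightarrow> 0) at_infinity"
proof
  assume vanish: "(f \<longlongrightarrow> 0) at_infinity"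
  then obtain z where max: "\<And>w. f w \<le> f z"
    using continuous_vanishing_at_infinity_attains_sup[OF cont _ \<open>f a > 0\<close>] by blast
  define S where "S = {w. f w = f z}"
  have "closed S"
    unfolding S_def using cont by (intro closed_Collect_eq continuous_on_const)
  moreover have "open S"
    unfolding open_contains_ball
  proof
    fix x assume "x \<in> S"
    then have x: "f x = f z" by (simp add: S_def)
    then obtain \<delta> where "\<delta> > 0" and \<delta>: "\<forall>w\<in>ball x \<delta>. f w = f x"
      using stable[of x] max by metis
    have "ball x \<delta> \<subseteq> S"
      using \<delta> unfolding S_def x by blast
    then show "\<exists>\<delta>>0. ball x \<delta> \<subseteq> S"
      using \<open>\<delta> > 0\<close> by blast
  qed
  ultimately have "S = UNIV"
    using clopen[of S] by (auto simp: S_def)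
  then have "f = (\<lambda>_. f z)"
    by (auto simp: S_def)
  then have "(f \<longlongrightarrow> f z) at_infinity"
    by (metis tendsto_const)
  then have "f z = 0"
    using vanish by (rule tendsto_unique[OF trivial_limit_at_infinity])
  then show False
    using max[of a] \<open>f a > 0\<close> by simp
qed

lemma sum_powers_roots_of_unity:
  assumes "0 < j" and "j < n"
  shows "(\<Sum>k<n. cis (2 * pi * real k / real n) ^ j) = 0"
proof -
  define \<omega> where "\<omega> = cis (2 * pi * real j / real n)"
  have "inj_on (\<lambda>k. cis (2 * pi * real k / real n)) {..<n}"
    using Complex.bij_betw_roots_unity[of n] assms by (simp add: bij_betw_def)
  from inj_onD[OF this, of j 0] have "\<omega> \<noteq> 1"
    using assms by (auto simp: \<omega>_def)
  moreover have "\<omega> ^ n = 1"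
    using assms by (simp add: \<omega>_def Complex.DeMoivre)
  moreover have "cis (2 * pi * real k / real n) ^ j = \<omega> ^ k" for k
    by (simp add: \<omega>_def Complex.DeMoivre mult_ac)
  ultimately show ?thesis
    by (simp add: geometric_sum)
qed

lemma le_power_mult_of_step:
  fixes a :: "nat \<Rightarrow> 'a::linordered_idom"
  assumes "c \<ge> 0" and "\<And>j. j < n \<Longrightarrow> a j \<le> c * a (Suc j)"
  shows "a 0 \<le> c ^ n * a n"
  using assms(2)
proof (induction n)
  case (Suc n)
  then have "a 0 \<le> c ^ n * a n" by simp
  also have "\<dots> \<le> c ^ n * (c * a (Suc n))"
    using \<open>c \<ge> 0\<close> Suc.prems by (intro mult_left_mono) auto
  finally show ?case by (simp add: mult_ac)
qed simp

locale complex_algebra = vector_space scale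
  for scale :: "complex \<Rightarrow> 'a::ring \<Rightarrow> 'a" (infixr \<open>*\<^sub>C\<close> 75) +
  assumes scale_mult_left: "(c *\<^sub>C x) * y = c *\<^sub>C (x * y)"
    and scale_mult_right: "x * (c *\<^sub>C y) = c *\<^sub>C (x * y)"

locale seminormed_complex_algebra = complex_algebra scale
  for scale :: "complex \<Rightarrow> 'a::ring \<Rightarrow> 'a" (infixr \<open>*\<^sub>C\<close> 75) +
  fixes q :: "'a \<Rightarrow> real" and e :: 'a
  assumes q_add: "q (x + y) \<le> q x + q y"
    and q_scale_le: "q (c *\<^sub>C x) \<le> cmod c * q x"
    and q_mult: "q (x * y) \<le> q x * q y"
    and q_left_id: "q (e * x - x) = 0"
    and q_right_id: "q (x * e - x) = 0"
    and q_id: "q e \<noteq> 0"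
begin

lemma q_scale: "q (c *\<^sub>C x) = cmod c * q x"
proof (cases "c = 0")
  case True
  have "q 0 \<le> 0" "0 \<le> q 0"
    using q_scale_le[of 0 0] q_add[of 0 0] by simp_all
  then show ?thesis
    using True by simp
next
  case False
  then have "q x \<le> (1 / cmod c) * q (c *\<^sub>C x)"
    using q_scale_le[of "1 / c" "c *\<^sub>C x"] by (simp add: norm_divide)
  then show ?thesis
    using q_scale_le[of c x] False by (intro antisym) (simp_all add: field_simps)
qed

lemma q_0 [simp]: "q 0 = 0"
  using q_scale[of 0 0] by simp

lemma q_minus: "q (- x) = q x"
  using q_scale[of "-1" x] by simp

lemma q_nonneg: "0 \<le> q x"
  using q_add[of x "- x"] by (simp add: q_minus)

lemma q_diff: "q (x - y) \<le> q x + q y"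
  using q_add[of x "- y"] by (simp add: q_minus)

lemma q_sum: "q (sum f I) \<le> (\<Sum>i\<in>I. q (f i))"
proof (induction I rule: infinite_finite_induct)
  case (insert i I)
  then show ?case
    using q_add[of "f i" "sum f I"] by simp
qed simp_all

definition cong :: "'a \<Rightarrow> 'a \<Rightarrow> bool" (infix \<open>\<simeq>\<close> 50) where
  "x \<simeq> y \<longleftrightarrow> q (x - y) = 0"

lemma cong_refl [simp]: "x \<simeq> x"
  by (simp add: cong_def)

lemma cong_sym: "x \<simeq> y \<Longrightarrow> y \<simeq> x"
  unfolding cong_def using q_minus[of "x - y"] by simp

lemma cong_add: "x \<simeq> y \<Longrightarrow> x' \<simeq> y' \<Longrightarrow> x + x' \<simeq> y + y'"
  unfolding cong_def using q_add[of "x - y" "x' - y'"] q_nonneg[of "x + x' - (y + y')"]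
  by (simp add: algebra_simps)

lemma cong_trans [trans]: "x \<simeq> y \<Longrightarrow> y \<simeq> z \<Longrightarrow> x \<simeq> z"
  using cong_add[of x y y z] by (simp add: cong_def algebra_simps)

lemma cong_scale: "x \<simeq> y \<Longrightarrow> c *\<^sub>C x \<simeq> c *\<^sub>C y"
  unfolding cong_def by (simp add: q_scale flip: scale_right_diff_distrib)

lemma cong_diff: "x \<simeq> y \<Longrightarrow> x' \<simeq> y' \<Longrightarrow> x - x' \<simeq> y - y'"
  using cong_add[of x y "- x'" "- y'"] cong_scale[of x' y' "-1"] by simp

lemma cong_sum: "(\<And>i. i \<in> I \<Longrightarrow> f i \<simeq> g i) \<Longrightarrow> sum f I \<simeq> sum g I"
  by (induction I rule: infinite_finite_induct) (auto intro: cong_add)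

lemma cong_mult_left: "x \<simeq> y \<Longrightarrow> a * x \<simeq> a * y"
  unfolding cong_def using q_mult[of a "x - y"] q_nonneg[of "a * (x - y)"]
  by (simp add: right_diff_distrib)

lemma cong_mult_right: "x \<simeq> y \<Longrightarrow> x * a \<simeq> y * a"
  unfolding cong_def using q_mult[of "x - y" a] q_nonneg[of "(x - y) * a"]
  by (simp add: left_diff_distrib)

lemma cong_left_id: "e * x \<simeq> x" and cong_right_id: "x * e \<simeq> x"
  by (simp_all add: cong_def q_left_id q_right_id)

lemma q_cong: "x \<simeq> y \<Longrightarrow> q x = q y"
  unfolding cong_def using q_add[of "x - y" y] q_diff[of x "x - y"] by simp

definition mutually_inverse :: "'a \<Rightarrow> 'a \<Rightarrow> bool" where
  "mutually_inverse a c \<longleftrightarrow> a * c \<simeq> e \<and> c * a \<simeq> e"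

lemma q_inverse_pos:
  assumes "mutually_inverse a c"
  shows "0 < q c"
proof -
  have "q e = q (a * c)"
    using assms q_cong[of "a * c" e] by (simp add: mutually_inverse_def)
  also have "\<dots> \<le> q a * q c" by (rule q_mult)
  finally show ?thesis
    using q_id q_nonneg[of e] q_nonneg[of c] by (cases "q c = 0") auto
qed

lemma resolvent_identity:
  assumes x: "mutually_inverse (b - \<zeta> *\<^sub>C e) x" and y: "mutually_inverse (b - \<mu> *\<^sub>C e) y"
  shows "y \<simeq> x + (\<mu> - \<zeta>) *\<^sub>C (x * y)"
proof -
  have left: "x * (b - \<zeta> *\<^sub>C e) \<simeq> e" and right: "(b - \<mu> *\<^sub>C e) * y \<simeq> e"
    using x y by (simp_all add: mutually_inverse_def)
  have "y \<simeq> e * y"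
    by (rule cong_sym[OF cong_left_id])
  also have "\<dots> \<simeq> x * (b - \<zeta> *\<^sub>C e) * y"
    by (intro cong_mult_right cong_sym[OF left])
  also have "\<dots> = x * ((b - \<mu> *\<^sub>C e) * y) + (\<mu> - \<zeta>) *\<^sub>C (x * (e * y))"
    by (simp add: scale_mult_left scale_mult_right algebra_simps)
  also have "\<dots> \<simeq> x * e + (\<mu> - \<zeta>) *\<^sub>C (x * y)"
    by (intro cong_add cong_scale cong_mult_left cong_left_id right)
  also have "\<dots> \<simeq> x + (\<mu> - \<zeta>) *\<^sub>C (x * y)"
    by (intro cong_add cong_right_id cong_refl)
  finally show ?thesis .
qed

lemma resolvent_inverse_norm_Lipschitz:
  assumes "mutually_inverse (b - \<zeta> *\<^sub>C e) x" and "mutually_inverse (b - \<mu> *\<^sub>C e) y"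
  shows "\<bar>1 / q x - 1 / q y\<bar> \<le> cmod (\<zeta> - \<mu>)"
proof -
  have one_sided: "1 / q x - 1 / q y \<le> cmod (\<zeta> - \<mu>)"
    if "mutually_inverse (b - \<zeta> *\<^sub>C e) x" "mutually_inverse (b - \<mu> *\<^sub>C e) y" for \<zeta> \<mu> x y
  proof -
    have "q y = q (x + (\<mu> - \<zeta>) *\<^sub>C (x * y))"
      by (rule q_cong[OF resolvent_identity[OF that]])
    also have "\<dots> \<le> q x + q ((\<mu> - \<zeta>) *\<^sub>C (x * y))"
      by (rule q_add)
    also have "\<dots> \<le> q x + cmod (\<mu> - \<zeta>) * (q x * q y)"
      unfolding q_scale by (intro add_left_mono mult_left_mono q_mult) simp
    finally show ?thesis
      using that[THEN q_inverse_pos] by (simp add: field_simps norm_minus_commute)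
  qed
  show ?thesis
    using one_sided[OF assms] one_sided[OF assms(2,1)] by (simp add: norm_minus_commute)
qed

lemma resolvent_decay:
  assumes "mutually_inverse (b - \<zeta> *\<^sub>C e) x"
  shows "(cmod \<zeta> - q b) * q x \<le> q e"
proof -
  have "\<zeta> *\<^sub>C x \<simeq> \<zeta> *\<^sub>C (e * x)"
    by (intro cong_scale cong_sym[OF cong_left_id])
  also have "\<dots> = b * x - (b - \<zeta> *\<^sub>C e) * x"
    by (simp add: scale_mult_left algebra_simps)
  also have "\<dots> \<simeq> b * x - e"
    using assms by (intro cong_diff cong_refl) (simp add: mutually_inverse_def)
  finally have "cmod \<zeta> * q x = q (b * x - e)"
    unfolding q_scale[symmetric] by (rule q_cong)
  also have "\<dots> \<le> q b * q x + q e"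
    using q_diff[of "b * x" e] q_mult[of b x] by simp
  finally show ?thesis
    by (simp add: algebra_simps)
qed

lemma resolvent_tendsto_0:
  assumes "\<forall>\<^sub>F \<zeta> in at_infinity. mutually_inverse (b - \<zeta> *\<^sub>C e) (r \<zeta>)"
  shows "((\<lambda>\<zeta>. q (r \<zeta>)) \<longlongrightarrow> 0) at_infinity"
proof (rule tendstoI)
  fix \<epsilon> :: real assume "\<epsilon> > 0"
  have "\<forall>\<^sub>F \<zeta> in at_infinity. cmod \<zeta> \<ge> q b + q e / \<epsilon> + 1"
    unfolding eventually_at_infinity by blast
  with assms show "\<forall>\<^sub>F \<zeta> in at_infinity. dist (q (r \<zeta>)) 0 < \<epsilon>"
  proof eventually_elim
    case (elim \<zeta>)
    have "(q e / \<epsilon>) * q (r \<zeta>) < (cmod \<zeta> - q b) * q (r \<zeta>)"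
      using elim q_inverse_pos by (intro mult_strict_right_mono) auto
    also have "\<dots> \<le> q e"
      by (rule resolvent_decay[OF elim(1)])
    finally show ?case
      using \<open>\<epsilon> > 0\<close> q_id q_nonneg[of e] q_nonneg[of "r \<zeta>"] by (simp add: field_simps)
  qed
qed

text \<open>The weighted sums \<open>M\<^sub>j = \<Sum>\<^sub>k z\<^sub>k\<^sup>j r\<^sub>k\<close> satisfy \<open>M\<^sub>0 \<simeq> n x + x M\<^sub>1\<close>, \<open>M\<^sub>j \<simeq> x M\<^sub>j\<^sub>+\<^sub>1\<close> for
  \<open>0 < j < n\<close>, and \<open>M\<^sub>n = \<mu>\<^sup>n M\<^sub>0\<close>.\<close>

lemma resolvent_mean_value:
  assumes x: "mutually_inverse (b - \<zeta> *\<^sub>C e) x" and "n > 0"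
    and r: "\<And>k. k < n \<Longrightarrow> mutually_inverse (b - (\<zeta> + cis (2 * pi * real k / real n) * \<mu>) *\<^sub>C e) (r k)"
  shows "n * q x \<le> (1 + (cmod \<mu> * q x) ^ n) * q (\<Sum>k<n. r k)"
proof -
  define z where "z k = cis (2 * pi * real k / real n) * \<mu>" for k
  define M where "M j = (\<Sum>k<n. z k ^ j *\<^sub>C r k)" for j
  have recursion: "M j \<simeq> (\<Sum>k<n. z k ^ j) *\<^sub>C x + x * M (Suc j)" for j
  proof -
    have "M j \<simeq> (\<Sum>k<n. z k ^ j *\<^sub>C (x + z k *\<^sub>C (x * r k)))"
      unfolding M_def
      using resolvent_identity[OF x r] by (intro cong_sum cong_scale) (simp add: z_def)
    also have "\<dots> = (\<Sum>k<n. z k ^ j) *\<^sub>C x + x * M (Suc j)"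
      by (simp add: M_def scale_right_distrib sum.distrib scale_sum_left sum_distrib_left
          scale_mult_right mult.commute)
    finally show ?thesis .
  qed
  have "(\<Sum>k<n. z k ^ j) = 0" if "0 < j" "j < n" for j
    using sum_powers_roots_of_unity[OF that]
    by (simp add: z_def power_mult_distrib flip: sum_distrib_right)
  then have "q (M j) \<le> q x * q (M (Suc j))" if "0 < j" "j < n" for j
    using q_cong[OF recursion[of j]] q_mult that by simp
  then have "q (M 1) \<le> q x ^ (n - 1) * q (M n)"
    using le_power_mult_of_step[of "q x" "n - 1" "\<lambda>j. q (M (Suc j))"] q_nonneg \<open>n > 0\<close> by simp
  then have "q x * q (M 1) \<le> q x * (q x ^ (n - 1) * q (M n))"
    by (intro mult_left_mono q_nonneg)
  also have "\<dots> = q x ^ n * q (M n)"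
    using \<open>n > 0\<close> by (simp add: power_eq_if)
  also have "z k ^ n = \<mu> ^ n" for k
    using \<open>n > 0\<close> by (simp add: z_def power_mult_distrib Complex.DeMoivre)
  then have "q (M n) = cmod \<mu> ^ n * q (M 0)"
    by (simp add: M_def q_scale norm_power flip: scale_sum_right)
  finally have tail: "q x * q (M 1) \<le> (cmod \<mu> * q x) ^ n * q (M 0)"
    by (simp add: power_mult_distrib mult_ac)
  have "of_nat n *\<^sub>C x \<simeq> M 0 - x * M 1"
    using cong_sym[OF cong_diff[OF recursion[of 0] cong_refl[of "x * M 1"]]] by simp
  then have "n * q x \<le> q (M 0) + q x * q (M 1)"
    using q_cong[of "of_nat n *\<^sub>C x"] q_diff[of "M 0" "x * M 1"] q_mult[of x "M 1"]
    by (simp add: q_scale)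
  then show ?thesis
    using tail by (simp add: M_def algebra_simps)
qed

lemma resolvent_max_stable:
  assumes r: "\<And>\<zeta>. cmod (\<zeta> - \<zeta>\<^sub>0) \<le> cmod \<mu> \<Longrightarrow> mutually_inverse (b - \<zeta> *\<^sub>C e) (r \<zeta>)"
    and max: "\<And>\<zeta>. cmod (\<zeta> - \<zeta>\<^sub>0) \<le> cmod \<mu> \<Longrightarrow> q (r \<zeta>) \<le> q (r \<zeta>\<^sub>0)"
    and \<mu>: "cmod \<mu> * q (r \<zeta>\<^sub>0) < 1"
  shows "q (r (\<zeta>\<^sub>0 + \<mu>)) = q (r \<zeta>\<^sub>0)"
proof (rule antisym)
  define m where "m = q (r \<zeta>\<^sub>0)"
  define \<tau> where "\<tau> = cmod \<mu> * m"
  have \<tau>: "0 \<le> \<tau>" "\<tau> < 1"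
    using \<mu> q_nonneg by (simp_all add: \<tau>_def m_def)
  have "m - m * (real n * \<tau> ^ n) \<le> q (r (\<zeta>\<^sub>0 + \<mu>))" if "n > 0" for n
  proof -
    define z where "z k = \<zeta>\<^sub>0 + cis (2 * pi * real k / real n) * \<mu>" for k
    have dist_z: "cmod (z k - \<zeta>\<^sub>0) \<le> cmod \<mu>" for k
      by (simp add: z_def norm_mult)
    have mean: "n * m \<le> (1 + \<tau> ^ n) * q (\<Sum>k<n. r (z k))"
      using resolvent_mean_value[of b \<zeta>\<^sub>0 "r \<zeta>\<^sub>0" n \<mu> "\<lambda>k. r (z k)"] r dist_z \<open>n > 0\<close>
      by (simp add: z_def m_def \<tau>_def)
    have "q (\<Sum>k<n. r (z k)) \<le> (\<Sum>k<n. q (r (z k)))" by (rule q_sum)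
    also have "\<dots> = q (r (z 0)) + (\<Sum>k\<in>{..<n} - {0}. q (r (z k)))"
      using \<open>n > 0\<close> by (intro sum.remove) auto
    also have "\<dots> \<le> q (r (z 0)) + (\<Sum>k\<in>{..<n} - {0}. m)"
      unfolding m_def by (intro add_left_mono sum_mono max dist_z)
    also have "\<dots> = q (r (\<zeta>\<^sub>0 + \<mu>)) + (real n - 1) * m"
      using \<open>n > 0\<close> by (simp add: z_def of_nat_diff)
    finally have sum_le: "q (\<Sum>k<n. r (z k)) \<le> q (r (\<zeta>\<^sub>0 + \<mu>)) + (real n - 1) * m" .
    also have "\<dots> \<le> n * m"
      using max[of "\<zeta>\<^sub>0 + \<mu>"] by (simp add: m_def algebra_simps)
    finally have "\<tau> ^ n * q (\<Sum>k<n. r (z k)) \<le> \<tau> ^ n * (n * m)"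
      using \<tau> by (intro mult_left_mono) auto
    then show ?thesis
      using mean sum_le by (simp add: algebra_simps)
  qed
  moreover have "(\<lambda>n. m - m * (real n * \<tau> ^ n)) \<longlonglongrightarrow> m - m * 0"
    using \<tau> by (intro tendsto_intros powser_times_n_limit_0) auto
  ultimately show "q (r \<zeta>\<^sub>0) \<le> q (r (\<zeta>\<^sub>0 + \<mu>))"
    unfolding m_def[symmetric]
    by (intro tendsto_upperbound[of _ m sequentially]) (auto intro!: eventually_sequentiallyI[of 1])
qed (rule max, simp)

theorem Gelfand_Mazur: "\<exists>\<zeta>. \<nexists>c. mutually_inverse (b - \<zeta> *\<^sub>C e) c"
proof (rule ccontr)
  assume "\<not> ?thesis"
  then obtain r where r: "\<And>\<zeta>. mutually_inverse (b - \<zeta> *\<^sub>C e) (r \<zeta>)" by metis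
  define N where "N \<zeta> = q (r \<zeta>)" for \<zeta>
  have N_pos: "N \<zeta> > 0" for \<zeta>
    unfolding N_def by (rule q_inverse_pos[OF r])
  have "1-lipschitz_on UNIV (\<lambda>\<zeta>. 1 / N \<zeta>)"
    using resolvent_inverse_norm_Lipschitz[OF r r]
    by (intro lipschitz_onI) (simp_all add: N_def dist_norm)
  then have "continuous_on UNIV (\<lambda>\<zeta>. inverse (1 / N \<zeta>))"
    using N_pos less_imp_neq by (intro continuous_on_inverse lipschitz_on_continuous_on) force+
  then have cont: "continuous_on UNIV N" by simp
  have "\<exists>\<delta>>0. \<forall>\<xi>\<in>ball \<zeta> \<delta>. N \<xi> = N \<zeta>" if max: "\<forall>\<xi>. N \<xi> \<le> N \<zeta>" for \<zeta>
  proof (intro exI conjI ballI)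
    fix \<xi> assume "\<xi> \<in> ball \<zeta> (1 / N \<zeta>)"
    then have "cmod (\<xi> - \<zeta>) * q (r \<zeta>) < 1"
      using N_pos[of \<zeta>] by (simp add: N_def dist_norm norm_minus_commute field_simps)
    then have "N (\<zeta> + (\<xi> - \<zeta>)) = N \<zeta>"
      unfolding N_def using max by (intro resolvent_max_stable[of _ _ b] r) (simp_all add: N_def)
    then show "N \<xi> = N \<zeta>" by simp
  qed (use N_pos in simp)
  from not_vanishing_at_infinity_if_maxima_stable[OF cont N_pos this]
  show False
    using resolvent_tendsto_0[OF always_eventually] r by (auto simp: N_def[abs_def])
qed

end

section \<open>Distances to subspaces and ideals\<close>

lemma infdist_less_iff:
  assumes "A \<noteq> {}"
  shows "infdist x A < K \<longleftrightarrow> (\<exists>a\<in>A. dist x a < K)"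
  using assms by (simp add: infdist_notempty cINF_less_iff bdd_belowI2[of _ 0])

lemma infdist_add_le:
  fixes M :: "'a::real_normed_vector set"
  assumes "subspace M"
  shows "infdist (x + y) M \<le> infdist x M + infdist y M"
proof (rule field_le_epsilon)
  fix \<epsilon> :: real assume "\<epsilon> > 0"
  have "M \<noteq> {}"
    using subspace_0[OF assms] by blast
  then obtain m n where "m \<in> M" "dist x m < infdist x M + \<epsilon> / 2"
    and "n \<in> M" "dist y n < infdist y M + \<epsilon> / 2"
    using infdist_less_iff[of M x] infdist_less_iff[of M y] \<open>\<epsilon> > 0\<close>
    by (metis less_add_same_cancel1 half_gt_zero)
  moreover from this have "infdist (x + y) M \<le> dist (x + y) (m + n)"
    by (intro infdist_le subspace_add assms)
  ultimately show "infdist (x + y) M \<le> infdist x M + infdist y M + \<epsilon>"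
    using dist_triangle_add[of x y m n] by simp
qed

lemma infdist_mult_le:
  fixes M :: "'a::real_normed_algebra set"
  assumes M: "subspace M" and left: "\<And>a m. m \<in> M \<Longrightarrow> a * m \<in> M"
    and right: "\<And>a m. m \<in> M \<Longrightarrow> m * a \<in> M"
  shows "infdist (x * y) M \<le> infdist x M * infdist y M"
proof -
  have "M \<noteq> {}"
    using subspace_0[OF M] by blast
  have "infdist (x * y) M \<le> (infdist x M + \<epsilon>) * (infdist y M + \<epsilon>)" if "\<epsilon> > 0" for \<epsilon>
  proof -
    obtain m where m: "m \<in> M" "dist x m < infdist x M + \<epsilon>"
      using infdist_less_iff[OF \<open>M \<noteq> {}\<close>, of x "infdist x M + \<epsilon>"] \<open>\<epsilon> > 0\<close> by auto
    obtain n where n: "n \<in> M" "dist y n < infdist y M + \<epsilon>"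
      using infdist_less_iff[OF \<open>M \<noteq> {}\<close>, of y "infdist y M + \<epsilon>"] \<open>\<epsilon> > 0\<close> by auto
    have "x * n + m * (y - n) \<in> M"
      using m n by (intro subspace_add[OF M] left right)
    then have "infdist (x * y) M \<le> norm (x * y - (x * n + m * (y - n)))"
      using infdist_le by (fastforce simp: dist_norm)
    also have "\<dots> = norm ((x - m) * (y - n))"
      by (simp add: algebra_simps)
    also have "\<dots> \<le> norm (x - m) * norm (y - n)"
      by (rule norm_mult_ineq)
    also have "\<dots> \<le> (infdist x M + \<epsilon>) * (infdist y M + \<epsilon>)"
      using m n \<open>\<epsilon> > 0\<close>
      by (intro mult_mono) (auto simp: dist_norm infdist_nonneg add_nonneg_nonneg less_imp_le)
    finally show ?thesis .
  qed
  then have "\<forall>\<^sub>F \<epsilon> in at_right 0. infdist (x * y) M \<le> (infdist x M + \<epsilon>) * (infdist y M + \<epsilon>)"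
    by (intro eventually_mono[OF eventually_at_right_less])
  moreover have "((\<lambda>\<epsilon>. (infdist x M + \<epsilon>) * (infdist y M + \<epsilon>)) \<longlongrightarrow>
      (infdist x M + 0) * (infdist y M + 0)) (at_right 0)"
    by (intro tendsto_intros)
  ultimately show ?thesis
    using tendsto_lowerbound[of _ _ "at_right 0"] by fastforce
qed

section \<open>Rings commutative modulo the right annihilator\<close>

locale comm_mod_rann_ring =
  fixes e :: "'a::ring"
  assumes right_id [simp]: "a * e = a"
    and commutator: "(a :: 'a) * b - b * a \<in> rann"
begin

lemma mult_left_id [simp]: "a * (e * x) = a * x"
  by (simp flip: mult.assoc)

lemma mult_right_commute: "(a :: 'a) * x * y = a * y * x"
proof -
  have "a * (x * y - y * x) = 0"
    using commutator[of x y] by (simp add: rann_def)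
  then show ?thesis
    by (simp add: right_diff_distrib mult.assoc)
qed

lemma diff_left_id_in_rann: "x - e * x \<in> rann"
  by (simp add: rann_def right_diff_distrib)

lemma center_Int_rann:
  fixes z :: 'a
  assumes "z \<in> center" and "z \<in> rann"
  shows "z = 0"
proof -
  have "z = z * e" by simp
  also have "\<dots> = e * z"
    using assms(1) unfolding center_def by blast
  finally show ?thesis
    using assms(2) by (simp add: rann_def)
qed

lemma quasi_invertibleI:
  fixes u :: 'a
  assumes "u + y - u * y \<in> rann"
  shows "quasi_invertible u"
proof -
  have correct: "\<exists>y'. u + y' - u * y' = 0" if "u + y - u * y \<in> rann" for u y :: 'a
  proof -
    define r where "r = u + y - u * y"
    have "u * r = 0"
      using that by (simp add: r_def rann_def)
    then have "u + (y - r) - u * (y - r) = u + y - u * y - r"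
      by (simp add: right_diff_distrib)
    also have "\<dots> = 0" by (simp add: r_def)
    finally show ?thesis by blast
  qed
  obtain y where y: "u + y - u * y = 0"
    using correct[OF assms] by blast
  then have "y + u - y * u = u * y - y * u"
    by (simp add: algebra_simps)
  then have "y + u - y * u \<in> rann"
    using commutator by simp
  then obtain z where z: "y + z - y * z = 0"
    using correct by blast
  have "(u * y) * z = u * (y * z)"
    by (rule mult.assoc)
  moreover have "u * y = u + y" "y * z = y + z"
    using y z by simp_all
  ultimately have "u = z"
    by (simp add: distrib_left distrib_right)
  with y z show ?thesis
    unfolding quasi_invertible_def by blast
qed

end

section \<open>Characters and maximal ideals\<close>

lemma contraction_mult_fixpoint:
  fixes v :: "'a::{real_normed_algebra,banach}"
  assumes "norm v < 1"
  shows "\<exists>y. c + v * y = y"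
proof -
  have "\<exists>!y. c + v * y = y"
  proof (rule banach_fix_type)
    show "\<forall>y z. dist (c + v * y) (c + v * z) \<le> norm v * dist y z"
      by (auto simp: dist_norm norm_mult_ineq simp flip: right_diff_distrib)
  qed (use assms in auto)
  then show ?thesis by blast
qed

locale comm_mod_rann_banach_algebra = comm_mod_rann_ring e
  for e :: "'a::{real_normed_algebra,banach}" +
  fixes sm :: "complex \<Rightarrow> 'a \<Rightarrow> 'a" (infixr \<open>*\<^sub>C\<close> 75)
  assumes complex_banach_algebra: "complex_banach_algebra sm"
begin

sublocale complex_algebra sm
proof
  show "1 *\<^sub>C x = x" for x
    using complex_banach_algebra unfolding complex_banach_algebra_def
    by (metis of_real_1 scaleR_one)
  show "x * (c *\<^sub>C y) = c *\<^sub>C (x * y)" for x c y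
    using complex_banach_algebra unfolding complex_banach_algebra_def by metis
qed (use complex_banach_algebra in \<open>simp_all add: complex_banach_algebra_def\<close>)

lemma scaleR_eq_scale: "r *\<^sub>R x = complex_of_real r *\<^sub>C x"
  and norm_scale: "norm (c *\<^sub>C x) = cmod c * norm x"
  using complex_banach_algebra by (simp_all add: complex_banach_algebra_def)

definition character :: "('a \<Rightarrow> complex) \<Rightarrow> bool" where
  "character \<phi> \<longleftrightarrow> (\<forall>x y. \<phi> (x + y) = \<phi> x + \<phi> y) \<and> (\<forall>c x. \<phi> (c *\<^sub>C x) = c * \<phi> x) \<and>
     (\<forall>x y. \<phi> (x * y) = \<phi> x * \<phi> y) \<and> \<phi> e = 1"

context
  fixes \<phi> assumes \<phi>: "character \<phi>"
begin

lemma character_add [simp]: "\<phi> (x + y) = \<phi> x + \<phi> y"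
  and character_scale [simp]: "\<phi> (c *\<^sub>C x) = c * \<phi> x"
  and character_mult [simp]: "\<phi> (x * y) = \<phi> x * \<phi> y"
  and character_id [simp]: "\<phi> e = 1"
  using \<phi> by (simp_all add: character_def)

lemma norm_character_le: "cmod (\<phi> x) \<le> norm x"
proof (rule ccontr)
  assume *: "\<not> ?thesis"
  define u where "u = (1 / \<phi> x) *\<^sub>C x"
  have "\<phi> x \<noteq> 0"
    using * character_scale[of 0 0] by auto
  then have u: "\<phi> u = 1" "norm u < 1"
    using * by (auto simp: u_def norm_scale norm_divide)
  obtain y where "u + u * y = y"
    using contraction_mult_fixpoint[OF u(2)] by blast
  then have "\<phi> (u + u * y) = \<phi> y" by simp
  then show False
    using u by simp
qed

lemma bounded_linear_character: "bounded_linear \<phi>"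
  using norm_character_le
  by (intro bounded_linear_intro[of _ 1]) (auto simp: scaleR_eq_scale scaleR_conv_of_real)

lemma character_0 [simp]: "\<phi> 0 = 0"
  and character_diff [simp]: "\<phi> (x - y) = \<phi> x - \<phi> y"
  and character_scaleR [simp]: "\<phi> (r *\<^sub>R x) = r *\<^sub>R \<phi> x"
  using bounded_linear.linear[OF bounded_linear_character]
  by (simp_all add: linear_0 linear_diff linear_scale)

end

definition ideal_over_rann :: "'a set \<Rightarrow> bool" where
  "ideal_over_rann M \<longleftrightarrow> subspace M \<and> rann \<subseteq> M \<and> (\<forall>a. \<forall>m\<in>M. a * m \<in> M)"

lemma ideal_subspace: "ideal_over_rann M \<Longrightarrow> subspace M"
  and rann_subset_ideal: "ideal_over_rann M \<Longrightarrow> rann \<subseteq> M"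
  and ideal_mult_left: "ideal_over_rann M \<Longrightarrow> m \<in> M \<Longrightarrow> a * m \<in> M"
  by (simp_all add: ideal_over_rann_def)

lemma ideal_commute: "ideal_over_rann M \<Longrightarrow> x * y - z \<in> M \<longleftrightarrow> y * x - z \<in> M"
  using subspace_add[OF ideal_subspace, of M "x * y - z" "y * x - x * y"]
    subspace_add[OF ideal_subspace, of M "y * x - z" "x * y - y * x"]
    subsetD[OF rann_subset_ideal, OF _ commutator] by fastforce

lemma ideal_mult_right: "ideal_over_rann M \<Longrightarrow> m \<in> M \<Longrightarrow> m * a \<in> M"
  using ideal_commute[of M m a 0] ideal_mult_left by simp

lemma subspace_rann: "subspace rann"
  by (auto simp: rann_def scale_mult_right distrib_left intro: subspaceI)

lemma ideal_rann: "ideal_over_rann rann"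
  by (auto simp: ideal_over_rann_def subspace_rann) (simp add: rann_def flip: mult.assoc)

lemma infdist_id_ideal_ge_1:
  assumes M: "ideal_over_rann M" and "e \<notin> M"
  shows "infdist e M \<ge> 1"
proof (rule ccontr)
  assume "\<not> ?thesis"
  then obtain m where "m \<in> M" and "norm (e - m) < 1"
    using infdist_less_iff[of M e 1] subspace_0[OF ideal_subspace[OF M]] by (auto simp: dist_norm)
  then obtain y where "e + (e - m) * y = y"
    using contraction_mult_fixpoint by blast
  then have "e = (y - e * y) + m * y"
    by (simp add: algebra_simps)
  also have "\<dots> \<in> M"
    using M \<open>m \<in> M\<close> diff_left_id_in_rann rann_subset_ideal
    by (intro subspace_add ideal_subspace ideal_mult_right) auto
  finally show False
    using \<open>e \<notin> M\<close> by simp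
qed

lemma seminormed_quotient:
  assumes M: "ideal_over_rann M" and "e \<notin> M"
  shows "seminormed_complex_algebra sm (\<lambda>x. infdist x M) e"
proof
  note sub = ideal_subspace[OF M]
  have real: "Real_Vector_Spaces.subspace M"
    using sub by (auto simp: real_vector.subspace_def subspace_def scaleR_eq_scale)
  show "infdist (x + y) M \<le> infdist x M + infdist y M" for x y
    by (rule infdist_add_le[OF real])
  show "infdist (x * y) M \<le> infdist x M * infdist y M" for x y
    by (intro infdist_mult_le real ideal_mult_left[OF M] ideal_mult_right[OF M])
  show "infdist (c *\<^sub>C x) M \<le> cmod c * infdist x M" for c x
  proof (cases "c = 0")
    case False
    have "infdist (c *\<^sub>C x) M / cmod c \<le> infdist x M"
    proof (rule dense_ge)
      fix K assume "infdist x M < K"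
      then obtain m where "m \<in> M" "dist x m < K"
        using infdist_less_iff[of M x K] subspace_0[OF sub] by auto
      then have "infdist (c *\<^sub>C x) M \<le> cmod c * K"
        using subspace_scale[OF sub] norm_scale[of c "x - m"]
        by (intro infdist_le2[of "c *\<^sub>C m"])
          (simp_all add: dist_norm scale_right_diff_distrib mult_left_mono)
      then show "infdist (c *\<^sub>C x) M / cmod c \<le> K"
        using False by (simp add: field_simps)
    qed
    then show ?thesis
      using False by (simp add: field_simps)
  qed (simp add: subspace_0[OF sub])
  have "x - e * x \<in> M" for x
    using diff_left_id_in_rann rann_subset_ideal[OF M] by blast
  then show "infdist (e * x - x) M = 0" for x
    using subspace_neg[OF sub, of "x - e * x"] by simp
  show "infdist (x * e - x) M = 0" for x
    by (simp add: subspace_0[OF sub])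
  show "infdist e M \<noteq> 0"
    using infdist_id_ideal_ge_1[OF assms] by simp
qed

definition adjoin :: "'a set \<Rightarrow> 'a \<Rightarrow> 'a set" where
  "adjoin M b = {c * b + m | c m. m \<in> M}"

lemma subset_adjoin: "M \<subseteq> adjoin M b"
  unfolding adjoin_def by (force intro: exI[of _ 0])

lemma mem_adjoin:
  assumes "ideal_over_rann M"
  shows "b \<in> adjoin M b"
proof -
  have "b = e * b + (b - e * b)" "b - e * b \<in> M"
    using diff_left_id_in_rann rann_subset_ideal[OF assms] by auto
  then show ?thesis
    unfolding adjoin_def by blast
qed

lemma ideal_adjoin:
  assumes M: "ideal_over_rann M"
  shows "ideal_over_rann (adjoin M b)"
  unfolding ideal_over_rann_def
proof (intro conjI allI ballI subspaceI)
  note sub = ideal_subspace[OF M]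
  show "rann \<subseteq> adjoin M b"
    using rann_subset_ideal[OF M] subset_adjoin by blast
  show "0 \<in> adjoin M b"
    using subset_adjoin subspace_0[OF sub] by blast
  fix x assume "x \<in> adjoin M b"
  then obtain c m where x: "m \<in> M" "x = c * b + m"
    by (auto simp: adjoin_def)
  show "k *\<^sub>C x \<in> adjoin M b" for k
  proof -
    have "k *\<^sub>C x = (k *\<^sub>C c) * b + k *\<^sub>C m" "k *\<^sub>C m \<in> M"
      using x subspace_scale[OF sub] by (simp_all add: scale_right_distrib scale_mult_left)
    then show ?thesis unfolding adjoin_def by blast
  qed
  show "a * x \<in> adjoin M b" for a
  proof -
    have "a * x = (a * c) * b + a * m" "a * m \<in> M"
      using x ideal_mult_left[OF M] by (simp_all add: distrib_left mult.assoc)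
    then show ?thesis unfolding adjoin_def by blast
  qed
  fix y assume "y \<in> adjoin M b"
  then obtain d n where "n \<in> M" "y = d * b + n"
    by (auto simp: adjoin_def)
  then have "x + y = (c + d) * b + (m + n)" "m + n \<in> M"
    using x subspace_add[OF sub] by (simp_all add: distrib_right)
  then show "x + y \<in> adjoin M b" unfolding adjoin_def by blast
qed

definition maximal_ideal :: "'a set \<Rightarrow> bool" where
  "maximal_ideal M \<longleftrightarrow> ideal_over_rann M \<and> e \<notin> M \<and>
     (\<forall>J. ideal_over_rann J \<longrightarrow> e \<notin> J \<longrightarrow> M \<subseteq> J \<longrightarrow> J = M)"

lemma ideal_Union_chain:
  assumes "\<C> \<noteq> {}" and chain: "subset.chain {J. ideal_over_rann J} \<C>"
  shows "ideal_over_rann (\<Union>\<C>)"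
  unfolding ideal_over_rann_def
proof (intro conjI allI ballI subspaceI)
  have \<C>: "ideal_over_rann J" if "J \<in> \<C>" for J
    using that chain by (auto simp: subset_chain_def)
  then show "rann \<subseteq> \<Union>\<C>"
    using \<open>\<C> \<noteq> {}\<close> rann_subset_ideal by fast
  then show "0 \<in> \<Union>\<C>"
    using subspace_0[OF subspace_rann] by blast
  show "c *\<^sub>C x \<in> \<Union>\<C>" "a * x \<in> \<Union>\<C>" if "x \<in> \<Union>\<C>" for c a x
    using that \<C> ideal_mult_left subspace_scale[OF ideal_subspace] by (meson Union_iff)+
  fix x y assume "x \<in> \<Union>\<C>" "y \<in> \<Union>\<C>"
  then obtain J where "J \<in> \<C>" "x \<in> J" "y \<in> J"
    using chain unfolding subset_chain_def by blast
  then show "x + y \<in> \<Union>\<C>"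
    using subspace_add[OF ideal_subspace[OF \<C>]] by blast
qed

lemma maximal_ideal_exists:
  assumes "ideal_over_rann I" and "e \<notin> I"
  obtains M where "maximal_ideal M" and "I \<subseteq> M"
proof -
  define \<A> where "\<A> = {J. ideal_over_rann J \<and> e \<notin> J \<and> I \<subseteq> J}"
  have "\<exists>M\<in>\<A>. \<forall>X\<in>\<A>. M \<subseteq> X \<longrightarrow> X = M"
  proof (rule subset_Zorn_nonempty)
    show "\<A> \<noteq> {}"
      using assms by (auto simp: \<A>_def)
    fix \<C> assume "\<C> \<noteq> {}" and chain: "subset.chain \<A> \<C>"
    then have "ideal_over_rann (\<Union>\<C>)"
      by (intro ideal_Union_chain) (auto simp: \<A>_def subset_chain_def)
    then show "\<Union>\<C> \<in> \<A>"
      using \<open>\<C> \<noteq> {}\<close> chain by (fastforce simp: \<A>_def subset_chain_def)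
  qed
  then obtain M where "M \<in> \<A>" and "\<forall>X\<in>\<A>. M \<subseteq> X \<longrightarrow> X = M" by blast
  then have "maximal_ideal M" "I \<subseteq> M"
    unfolding maximal_ideal_def \<A>_def by auto
  then show ?thesis by (rule that)
qed

lemma maximal_ideal_inverse:
  assumes "maximal_ideal M" and "b \<notin> M"
  shows "\<exists>c. c * b - e \<in> M"
proof -
  have M: "ideal_over_rann M"
    using assms(1) by (simp add: maximal_ideal_def)
  then have "e \<in> adjoin M b"
    using assms ideal_adjoin[OF M] mem_adjoin[OF M] subset_adjoin
    unfolding maximal_ideal_def by blast
  then obtain c m where "m \<in> M" "e = c * b + m"
    by (auto simp: adjoin_def)
  then have "c * b - e = - m" by simp
  then show ?thesis
    using subspace_neg[OF ideal_subspace[OF M] \<open>m \<in> M\<close>] by metis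
qed

lemma maximal_ideal_scalar:
  assumes max: "maximal_ideal M"
  shows "\<exists>\<zeta>. x - \<zeta> *\<^sub>C e \<in> M"
proof -
  have M: "ideal_over_rann M" and "e \<notin> M"
    using max by (simp_all add: maximal_ideal_def)
  then interpret seminormed_complex_algebra sm "\<lambda>x. infdist x M" e
    by (rule seminormed_quotient)
  obtain \<zeta> where "\<nexists>c. mutually_inverse (x - \<zeta> *\<^sub>C e) c"
    using Gelfand_Mazur by blast
  moreover have "mutually_inverse (x - \<zeta> *\<^sub>C e) c" if "c * (x - \<zeta> *\<^sub>C e) - e \<in> M" for c
    using that ideal_commute[OF M, of c] by (simp add: mutually_inverse_def cong_def)
  ultimately have "\<nexists>c. c * (x - \<zeta> *\<^sub>C e) - e \<in> M" by blast
  then show ?thesis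
    using maximal_ideal_inverse[OF max] by blast
qed

lemma character_of_maximal_ideal:
  assumes max: "maximal_ideal M"
  obtains \<phi> where "character \<phi>" and "\<And>x. x \<in> M \<Longrightarrow> \<phi> x = 0"
proof -
  have M: "ideal_over_rann M" and "e \<notin> M"
    using max by (simp_all add: maximal_ideal_def)
  note sub = ideal_subspace[OF M]
  obtain \<phi> where \<phi>: "\<And>x. x - \<phi> x *\<^sub>C e \<in> M"
    using maximal_ideal_scalar[OF max] by metis
  have unique: "\<phi> x = c" if "x - c *\<^sub>C e \<in> M" for x c
  proof (rule ccontr)
    assume "\<phi> x \<noteq> c"
    have "(\<phi> x - c) *\<^sub>C e \<in> M"
      using subspace_diff[OF sub that \<phi>[of x]] by (simp add: scale_left_diff_distrib)
    from subspace_scale[OF sub this, of "1 / (\<phi> x - c)"] show False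
      using \<open>\<phi> x \<noteq> c\<close> \<open>e \<notin> M\<close> by simp
  qed
  have "character \<phi>"
    unfolding character_def
  proof (intro conjI allI unique)
    show "x + y - (\<phi> x + \<phi> y) *\<^sub>C e \<in> M" for x y
      using subspace_add[OF sub \<phi>[of x] \<phi>[of y]] by (simp add: algebra_simps)
    show "c *\<^sub>C x - (c * \<phi> x) *\<^sub>C e \<in> M" for c x
      using subspace_scale[OF sub \<phi>[of x], of c] by (simp add: scale_right_diff_distrib)
    have "x * y - (\<phi> x * \<phi> y) *\<^sub>C e = x * (y - \<phi> y *\<^sub>C e) + \<phi> y *\<^sub>C (x - \<phi> x *\<^sub>C e)" for x y
      by (simp add: right_diff_distrib scale_mult_right scale_right_diff_distrib mult.commute)
    then show "x * y - (\<phi> x * \<phi> y) *\<^sub>C e \<in> M" for x y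
      using \<phi> by (simp add: subspace_add[OF sub] subspace_scale[OF sub] ideal_mult_left[OF M])
    show "e - 1 *\<^sub>C e \<in> M"
      by (simp add: subspace_0[OF sub])
  qed
  moreover have "\<phi> x = 0" if "x \<in> M" for x
    using that by (intro unique) simp
  ultimately show ?thesis by (rule that)
qed

lemma characters_separate_modulo_jrad:
  assumes x: "\<And>\<phi>. character \<phi> \<Longrightarrow> \<phi> x = 0"
  shows "x \<in> jrad"
  unfolding jrad_def mem_Collect_eq
proof (rule allI, rule ccontr)
  fix a assume not_quasi_invertible: "\<not> quasi_invertible (a * x)"
  define u where "u = a * x"
  have "e \<notin> adjoin rann (e - u)"
  proof
    assume "e \<in> adjoin rann (e - u)"
    then obtain c r where "r \<in> rann" and "e = c * (e - u) + r"
      by (auto simp: adjoin_def)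
    then have "u + (e - c) - u * (e - c) = r + (u * c - c * u)"
      by (simp add: algebra_simps)
    also have "\<dots> \<in> rann"
      by (intro subspace_add subspace_rann \<open>r \<in> rann\<close> commutator)
    finally have "quasi_invertible u" by (rule quasi_invertibleI)
    then show False
      using not_quasi_invertible by (simp add: u_def)
  qed
  then obtain M where M: "maximal_ideal M" "adjoin rann (e - u) \<subseteq> M"
    using maximal_ideal_exists ideal_adjoin[OF ideal_rann] by metis
  obtain \<phi> where \<phi>: "character \<phi>" "\<And>x. x \<in> M \<Longrightarrow> \<phi> x = 0"
    using character_of_maximal_ideal[OF M(1)] by blast
  have "\<phi> (e - u) = 0"
    using M(2) mem_adjoin[OF ideal_rann] \<phi>(2) by blast
  then show False
    using x[OF \<phi>(1)] \<phi>(1) by (simp add: u_def)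
qed

end

section \<open>Johnson's theorem: continuity of derivations\<close>

context comm_mod_rann_banach_algebra
begin

lemma countable_characters_separating_element:
  assumes "countable F" and F: "\<And>\<phi>. \<phi> \<in> F \<Longrightarrow> character \<phi>"
  obtains x where "inj_on (\<lambda>\<phi>. \<phi> x) F"
proof -
  define I where "I = {(\<phi>, \<psi>) \<in> F \<times> F. \<phi> \<noteq> \<psi>}"
  have "\<exists>x. \<forall>i\<in>I. fst i x - snd i x \<noteq> 0"
  proof (rule countable_functionals_common_nonzero)
    have "I \<subseteq> F \<times> F"
      by (auto simp: I_def)
    then show "countable I"
      using \<open>countable F\<close> by (auto intro: countable_subset)
    show "bounded_linear (\<lambda>x. fst i x - snd i x)" if "i \<in> I" for i
      using that F by (intro bounded_linear_sub bounded_linear_character) (auto simp: I_def)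
    show "\<exists>v. fst i v - snd i v \<noteq> 0" if "i \<in> I" for i
      using that by (auto simp: I_def fun_eq_iff)
  qed
  then obtain x where x: "\<And>i. i \<in> I \<Longrightarrow> fst i x \<noteq> snd i x" by auto
  have "inj_on (\<lambda>\<phi>. \<phi> x) F"
  proof (rule inj_onI)
    show "\<phi> = \<psi>" if "\<phi> \<in> F" "\<psi> \<in> F" "\<phi> x = \<psi> x" for \<phi> \<psi>
      using that x[of "(\<phi>, \<psi>)"] by (auto simp: I_def)
  qed
  then show ?thesis by (rule that)
qed

lemma characters_interpolation:
  assumes "finite F" and "\<And>\<psi>. \<psi> \<in> F \<Longrightarrow> character \<psi>" and "character \<phi>" and "\<phi> \<notin> F"
  shows "\<exists>p. \<phi> p = 1 \<and> (\<forall>\<psi>\<in>F. \<psi> p = 0)"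
  using assms
proof (induction F)
  case empty
  then show ?case
    by (intro exI[of _ e]) simp
next
  case (insert \<psi> F)
  then obtain p where p: "\<phi> p = 1" "\<forall>\<theta>\<in>F. \<theta> p = 0" by auto
  obtain x where x: "\<phi> x \<noteq> \<psi> x"
    using insert.prems by blast
  define b where "b = (1 / (\<phi> x - \<psi> x)) *\<^sub>C (x - \<psi> x *\<^sub>C e)"
  have "\<phi> b = 1" "\<psi> b = 0"
    using x insert.prems by (simp_all add: b_def)
  then show ?case
    using p insert.prems by (intro exI[of _ "p * b"]) auto
qed

end

locale algebra_derivation = comm_mod_rann_banach_algebra +
  fixes D :: "'a \<Rightarrow> 'a"
  assumes derivation: "derivation sm D"
begin

lemma D_add: "D (x + y) = D x + D y"
  and D_scale: "D (c *\<^sub>C x) = c *\<^sub>C D x"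
  and D_mult: "D (x * y) = D x * y + x * D y"
  using derivation by (auto simp: derivation_def clinear_map_def)

lemma linear_D: "linear D"
  by (intro linearI) (simp_all add: D_add D_scale scaleR_eq_scale)

lemma character_D_id:
  assumes "character \<phi>"
  shows "\<phi> (D e) = 0"
proof -
  have "\<phi> (D e) = \<phi> (D e * e + e * D e)"
    using D_mult[of e e] by simp
  also have "\<dots> = \<phi> (D e) + \<phi> (D e)"
    using assms by (simp del: right_id)
  finally show ?thesis by simp
qed

lemma character_D_compose_upto_mult:
  fixes b :: "nat \<Rightarrow> 'a"
  defines "P \<equiv> compose_upto (\<lambda>k. (*) (b k))"
  assumes \<phi>: "character \<phi>"
  shows "\<phi> (D (P n z)) = (\<Prod>k<n. \<phi> (b k)) * \<phi> (D z) + \<phi> (D (P n e)) * \<phi> z"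
proof (induction n arbitrary: z)
  case 0
  show ?case
    using \<phi> by (simp add: P_def character_D_id)
next
  case (Suc n)
  show ?case
    using \<phi> Suc.IH[of "b n * z"] Suc.IH[of "b n"] by (simp add: P_def D_mult algebra_simps)
qed

definition discontinuous_chars :: "('a \<Rightarrow> complex) set" where
  "discontinuous_chars = {\<phi>. character \<phi> \<and> \<not> bounded_linear (\<phi> \<circ> D)}"

lemma separated_characters_ex_bounded_D:
  fixes \<phi> :: "nat \<Rightarrow> 'a \<Rightarrow> complex"
  assumes char: "\<And>n. character (\<phi> n)" and b_le: "\<And>n. norm (b n) \<le> 1"
    and b: "\<And>k n. \<phi> k (b n) = 0 \<longleftrightarrow> k = n"
  shows "\<exists>n. bounded_linear (\<phi> n \<circ> D)"
proof -
  define P where "P = compose_upto (\<lambda>k. (*) (b k))"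
  define \<gamma> where "\<gamma> n j = \<phi> n (D (P j e))" for n j
  have P: "\<phi> n (D (P j z)) = (\<Prod>k<j. \<phi> n (b k)) * \<phi> n (D z) + \<gamma> n j * \<phi> n z" for n j z
    unfolding P_def \<gamma>_def by (rule character_D_compose_upto_mult[OF char])
  have \<phi>: "bounded_linear (\<phi> n)" for n
    by (rule bounded_linear_character[OF char])
  have "\<exists>n. bounded_linear ((\<phi> n \<circ> D) \<circ> P n)"
    unfolding P_def
  proof (rule gliding_hump)
    show "norm (b n * z) \<le> norm z" for n z
      using norm_mult_ineq[of "b n" z] mult_right_mono[OF b_le, of "norm z" n] by simp
    show "linear (\<phi> n \<circ> D)" for n
      by (intro linear_compose linear_D bounded_linear.linear \<phi>)
    show "bounded (range (\<lambda>n. (\<phi> n \<circ> D) z))" for z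
      using norm_character_le[OF char] by (intro boundedI[of _ "norm (D z)"]) auto
    have "(\<phi> n \<circ> D) \<circ> P (Suc n) = (\<lambda>z. \<gamma> n (Suc n) * \<phi> n z)" for n
      using b[of n n] by (simp add: fun_eq_iff P del: compose_upto.simps)
    then show "bounded_linear ((\<phi> n \<circ> D) \<circ> compose_upto (\<lambda>k. (*) (b k)) (Suc n))" for n
      using bounded_linear_const_mult[OF \<phi>] by (simp add: P_def del: compose_upto.simps)
  qed (rule bounded_linear_mult_right)
  then obtain n where bounded: "bounded_linear (\<lambda>z. \<phi> n (D (P n z)))"
    by (auto simp: comp_def)
  define \<beta> where "\<beta> = (\<Prod>k<n. \<phi> n (b k))"
  have "\<beta> \<noteq> 0"
    using b by (simp add: \<beta>_def)
  then have "\<phi> n \<circ> D = (\<lambda>z. inverse \<beta> * (\<phi> n (D (P n z)) - \<gamma> n n * \<phi> n z))"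
    by (simp add: fun_eq_iff P field_simps flip: \<beta>_def)
  moreover have "bounded_linear (\<lambda>z. inverse \<beta> * (\<phi> n (D (P n z)) - \<gamma> n n * \<phi> n z))"
    by (intro bounded_linear_const_mult bounded_linear_sub bounded \<phi>)
  ultimately have "bounded_linear (\<phi> n \<circ> D)" by metis
  then show ?thesis by blast
qed

lemma finite_discontinuous_chars: "finite discontinuous_chars"
proof (rule ccontr)
  assume "infinite discontinuous_chars"
  then obtain \<phi> :: "nat \<Rightarrow> 'a \<Rightarrow> complex" where "inj \<phi>" and "range \<phi> \<subseteq> discontinuous_chars"
    using infinite_countable_subset by blast
  then have char: "character (\<phi> n)" and discontinuous: "\<not> bounded_linear (\<phi> n \<circ> D)" for n
    by (auto simp: discontinuous_chars_def)
  obtain x where x: "inj_on (\<lambda>\<psi>. \<psi> x) (range \<phi>)"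
    using countable_characters_separating_element[of "range \<phi>"] char by auto
  define v where "v n = x - \<phi> n x *\<^sub>C e" for n
  have "\<phi> k (sgn (v n)) = 0 \<longleftrightarrow> k = n" for k n
  proof -
    have "\<phi> k (sgn (v n)) = 0 \<longleftrightarrow> \<phi> k (v n) = 0"
      using char[of k] by (cases "v n = 0") (simp_all add: sgn_div_norm)
    also have "\<dots> \<longleftrightarrow> \<phi> k x = \<phi> n x"
      using char[of k] by (simp add: v_def)
    also have "\<dots> \<longleftrightarrow> k = n"
      using x \<open>inj \<phi>\<close> by (auto simp: inj_on_def inj_def)
    finally show ?thesis .
  qed
  then have "\<exists>n. bounded_linear (\<phi> n \<circ> D)"
    by (intro separated_characters_ex_bounded_D[of _ "\<lambda>n. sgn (v n)"] char)
      (simp_all add: norm_sgn)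
  then show False
    using discontinuous by blast
qed

end

locale comm_mod_radical_banach_algebra = comm_mod_rann_banach_algebra +
  assumes jrad_eq_rann: "(jrad :: 'a set) = rann"
begin

lemma eq_0_if_characters_vanish:
  assumes "e * y = y" and "\<And>\<phi>. character \<phi> \<Longrightarrow> \<phi> y = 0"
  shows "y = 0"
proof -
  have "y \<in> jrad"
    by (rule characters_separate_modulo_jrad) (rule assms(2))
  then have "e * y = 0"
    by (simp add: jrad_eq_rann rann_def)
  then show ?thesis
    using assms(1) by simp
qed

end

locale left_fixed_derivation =
  algebra_derivation e sm D + comm_mod_radical_banach_algebra e sm
  for e :: "'a::{real_normed_algebra,banach}" and sm (infixr \<open>*\<^sub>C\<close> 75) and D +
  assumes left_id_D [simp]: "e * D x = D x"
begin

lemma D_eqI: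
  assumes "\<And>\<phi>. character \<phi> \<Longrightarrow> \<phi> x = \<phi> y"
  shows "D x = D y"
proof -
  define r where "r = x - y"
  have "r \<in> rann"
    unfolding jrad_eq_rann[symmetric] r_def
    by (rule characters_separate_modulo_jrad) (simp add: assms)
  then have "e * D r = 0"
    using D_mult[of e r] linear_0[OF linear_D] by (simp add: rann_def)
  then have "D r = 0" by simp
  then show ?thesis
    by (simp add: r_def linear_diff[OF linear_D])
qed

text \<open>Here \<open>w\<close> plays the role of the characteristic function of the isolated point \<open>\<phi>\<close> of the
  character space.\<close>

lemma point_derivation_isolated:
  assumes \<phi>: "character \<phi>" and w: "\<phi> w = 1" "\<And>\<psi>. character \<psi> \<Longrightarrow> \<psi> \<noteq> \<phi> \<Longrightarrow> \<psi> w = 0"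
  shows "\<phi> (D x) = 0"
proof -
  have "D (w * x) = D (\<phi> x *\<^sub>C w)"
  proof (rule D_eqI)
    fix \<theta> assume "character \<theta>"
    then show "\<theta> (w * x) = \<theta> (\<phi> x *\<^sub>C w)"
      using w by (cases "\<theta> = \<phi>") auto
  qed
  then have "\<phi> (D w * x + w * D x) = \<phi> (\<phi> x *\<^sub>C D w)"
    by (simp add: D_mult D_scale)
  then show ?thesis
    using \<phi> w by (simp add: mult.commute)
qed

theorem bounded_linear_D: "bounded_linear D"
proof (rule closed_graph[OF linear_D])
  fix X y assume X: "X \<longlonglongrightarrow> 0" and y: "(\<lambda>n. D (X n)) \<longlonglongrightarrow> y"
  have continuous_zero: "\<psi> y = 0" if \<psi>: "character \<psi>" "\<psi> \<notin> discontinuous_chars" for \<psi>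
  proof (rule LIMSEQ_unique)
    show "(\<lambda>n. \<psi> (D (X n))) \<longlonglongrightarrow> \<psi> y"
      using bounded_linear_character[OF \<psi>(1)] y by (rule bounded_linear.tendsto)
    have "bounded_linear (\<psi> \<circ> D)"
      using \<psi> by (simp add: discontinuous_chars_def)
    from bounded_linear.tendsto[OF this X] show "(\<lambda>n. \<psi> (D (X n))) \<longlonglongrightarrow> 0"
      using \<psi>(1) by (simp add: linear_0[OF linear_D])
  qed
  have "\<phi> y = 0" if \<phi>: "character \<phi>" for \<phi>
  proof (rule ccontr)
    assume "\<phi> y \<noteq> 0"
    then have discontinuous: "\<not> bounded_linear (\<phi> \<circ> D)"
      using continuous_zero \<phi> by (auto simp: discontinuous_chars_def)
    have "\<exists>p. \<phi> p = 1 \<and> (\<forall>\<psi>\<in>discontinuous_chars - {\<phi>}. \<psi> p = 0)"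
      by (rule characters_interpolation)
        (use finite_discontinuous_chars \<phi> in \<open>auto simp: discontinuous_chars_def\<close>)
    then obtain p where p: "\<phi> p = 1" "\<forall>\<psi>\<in>discontinuous_chars - {\<phi>}. \<psi> p = 0"
      by blast
    define w where "w = (1 / \<phi> y) *\<^sub>C (p * y)"
    have "\<phi> (D x) = 0" for x
    proof (rule point_derivation_isolated[OF \<phi>])
      show "\<phi> w = 1"
        using \<phi> \<open>\<phi> y \<noteq> 0\<close> p by (simp add: w_def)
      show "\<psi> w = 0" if "character \<psi>" "\<psi> \<noteq> \<phi>" for \<psi>
        using that p continuous_zero[of \<psi>] by (cases "\<psi> \<in> discontinuous_chars") (auto simp: w_def)
    qed
    then show False
      using discontinuous by (simp add: comp_def)
  qed
  moreover have "(\<lambda>n. D (X n)) \<longlonglongrightarrow> e * y"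
    using tendsto_mult_left[OF y, of e] by simp
  then have "e * y = y"
    using y by (rule LIMSEQ_unique)
  ultimately show "y = 0"
    by (intro eq_0_if_characters_vanish)
qed

end

section \<open>The Singer--Wermer theorem: derivations vanish\<close>

definition exp_derivation_series :: "('a \<Rightarrow> 'b::field_char_0) \<Rightarrow> ('a \<Rightarrow> 'a) \<Rightarrow> 'a \<Rightarrow> 'b fps" where
  "exp_derivation_series \<phi> D x = Abs_fps (\<lambda>n. \<phi> ((D ^^ n) x) / fact n)"

lemma fps_deriv_exp_derivation_series:
  "fps_deriv (exp_derivation_series \<phi> D x) = exp_derivation_series \<phi> D (D x)"
  by (rule fps_ext) (simp add: exp_derivation_series_def funpow_swap1 del: of_nat_Suc)

context
  fixes \<phi> :: "'a::ring \<Rightarrow> 'b::field_char_0" and D :: "'a \<Rightarrow> 'a"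
  assumes \<phi>_add: "\<And>x y. \<phi> (x + y) = \<phi> x + \<phi> y" and \<phi>_mult: "\<And>x y. \<phi> (x * y) = \<phi> x * \<phi> y"
    and D_add: "\<And>x y. D (x + y) = D x + D y" and D_mult: "\<And>x y. D (x * y) = D x * y + x * D y"
begin

lemma exp_derivation_series_add:
  "exp_derivation_series \<phi> D (x + y) = exp_derivation_series \<phi> D x + exp_derivation_series \<phi> D y"
proof (rule fps_ext)
  have "(D ^^ n) (x + y) = (D ^^ n) x + (D ^^ n) y" for n
    by (induction n) (simp_all add: D_add)
  then show "fps_nth (exp_derivation_series \<phi> D (x + y)) n =
      fps_nth (exp_derivation_series \<phi> D x + exp_derivation_series \<phi> D y) n" for n
    by (simp add: exp_derivation_series_def \<phi>_add add_divide_distrib)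
qed

lemma exp_derivation_series_mult:
  "exp_derivation_series \<phi> D (x * y) = exp_derivation_series \<phi> D x * exp_derivation_series \<phi> D y"
proof (rule fps_ext)
  define E where "E = exp_derivation_series \<phi> D"
  have E_deriv: "fps_deriv (E x) = E (D x)" for x
    by (simp add: E_def fps_deriv_exp_derivation_series)
  have "fps_nth (E (x * y)) n = fps_nth (E x * E y) n" for n
  proof (induction n arbitrary: x y)
    case 0
    show ?case by (simp add: E_def exp_derivation_series_def \<phi>_mult)
  next
    case (Suc n)
    have "of_nat (Suc n) * fps_nth (E (x * y)) (Suc n) = fps_nth (fps_deriv (E (x * y))) n"
      by simp
    also have "\<dots> = fps_nth (E (D x * y)) n + fps_nth (E (x * D y)) n"
      by (simp only: E_deriv D_mult) (simp add: E_def exp_derivation_series_add)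
    also have "\<dots> = fps_nth (fps_deriv (E x * E y)) n"
      by (simp add: Suc.IH E_deriv)
    also have "\<dots> = of_nat (Suc n) * fps_nth (E x * E y) (Suc n)"
      by (simp only: fps_deriv_nth) simp
    finally show ?case
      by (simp del: of_nat_Suc)
  qed
  then show "fps_nth (exp_derivation_series \<phi> D (x * y)) n =
      fps_nth (exp_derivation_series \<phi> D x * exp_derivation_series \<phi> D y) n" for n
    by (simp add: E_def)
qed

lemma iterated_derivation_power:
  assumes "\<phi> a = 0"
  shows "\<phi> ((D ^^ Suc n) (((*) a ^^ n) a)) = fact (Suc n) * \<phi> (D a) ^ Suc n"
proof -
  define E where "E = exp_derivation_series \<phi> D"
  have "E (((*) a ^^ n) a) = E a ^ Suc n"
    by (induction n) (simp_all add: E_def exp_derivation_series_mult)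
  moreover have "fps_nth (E a) 0 = 0"
    by (simp add: E_def exp_derivation_series_def assms)
  ultimately have "fps_nth (E (((*) a ^^ n) a)) (Suc n) = fps_nth (E a) 1 ^ Suc n"
    by (simp only: startsby_zero_power_nth_same)
  then have "\<phi> ((D ^^ Suc n) (((*) a ^^ n) a)) / fact (Suc n) = \<phi> (D a) ^ Suc n"
    by (simp only: E_def exp_derivation_series_def fps_nth_Abs_fps) simp
  then show ?thesis
    by (simp only: nonzero_divide_eq_eq[OF fact_nonzero] mult.commute[of "fact (Suc n)"])
qed

end

context left_fixed_derivation
begin

lemma character_D_kernel:
  assumes \<phi>: "character \<phi>" and a: "\<phi> a = 0"
  shows "\<phi> (D a) = 0"
proof (rule ccontr)
  assume nonzero: "\<phi> (D a) \<noteq> 0"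
  obtain K where "K > 0" and K: "\<And>x. norm (D x) \<le> K * norm x"
    using bounded_linear.pos_bounded[OF bounded_linear_D] by (metis mult.commute)
  define t where "t = K * norm a / cmod (\<phi> (D a))"
  have "1 \<le> t ^ Suc n / fact (Suc n)" for n
  proof -
    define p where "p = ((*) a ^^ n) a"
    have "fact (Suc n) * cmod (\<phi> (D a)) ^ Suc n = cmod (\<phi> ((D ^^ Suc n) p))"
      using iterated_derivation_power[of \<phi> D a n] \<phi> a
      by (simp add: p_def D_add D_mult norm_mult norm_power del: funpow.simps fact_Suc power_Suc)
    also have "\<dots> \<le> norm ((D ^^ Suc n) p)"
      by (rule norm_character_le[OF \<phi>])
    also have "\<dots> \<le> K ^ Suc n * norm p"
      using \<open>K > 0\<close> K by (intro norm_funpow_le) auto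
    also have "\<dots> \<le> K ^ Suc n * (norm a ^ n * norm a)"
      unfolding p_def using \<open>K > 0\<close>
      by (intro mult_left_mono norm_funpow_le norm_mult_ineq) auto
    finally show ?thesis
      using nonzero by (simp add: t_def power_divide power_mult_distrib field_simps del: fact_Suc)
  qed
  moreover have "(\<lambda>n. t ^ Suc n / fact (Suc n)) \<longlonglongrightarrow> 0"
    using LIMSEQ_Suc[OF summable_LIMSEQ_zero[OF summable_exp[of t]]]
    by (simp add: divide_inverse mult.commute)
  ultimately have "1 \<le> (0 :: real)"
    by (intro tendsto_lowerbound[where F = sequentially]) auto
  then show False by simp
qed

theorem derivation_eq_0: "D x = 0"
proof (rule eq_0_if_characters_vanish)
  fix \<phi> assume \<phi>: "character \<phi>"
  have "\<phi> (D (x - \<phi> x *\<^sub>C e)) = 0"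
    by (rule character_D_kernel[OF \<phi>]) (simp add: \<phi>)
  then show "\<phi> (D x) = 0"
    using \<phi> by (simp add: linear_diff[OF linear_D] D_scale character_D_id)
qed simp

end

section \<open>Centralizing generalized derivations\<close>

lemma (in comm_mod_rann_ring) centralizing_derivation_left_id:
  assumes "centralizing \<delta>" and \<delta>: "\<And>a b. \<delta> (a * b) = a * \<delta> b + d a * b"
    and d_add: "\<And>a b. d (a + b) = d a + d b" and d_mult: "\<And>a b. d (a * b) = d a * b + a * d b"
  shows "e * d a = d a"
proof -
  have \<delta>_eq: "\<delta> a = a * \<delta> e + d a" for a
    using \<delta>[of a e] by simp
  have commute: "d a * a = a * d a" for a
  proof -
    have "\<delta> a * a - a * \<delta> a = 0"
      using \<open>centralizing \<delta>\<close> by (intro center_Int_rann commutator) (simp add: centralizing_def)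
    then show ?thesis
      unfolding \<delta>_eq[of a] using mult_right_commute[of a "\<delta> e" a]
      by (simp add: distrib_left distrib_right mult.assoc)
  qed
  have "a * d e = 0" for a
    using d_mult[of a e] by simp
  then have "d e = 0"
    using commute[of e] by simp
  then show ?thesis
    using commute[of "a + e"] commute[of a] by (simp add: d_add distrib_left distrib_right)
qed

definition right_mult :: "'a::times \<Rightarrow> 'a \<Rightarrow> 'a" where
  "right_mult x = (\<lambda>a. a * x)"

context comm_mod_rann_banach_algebra
begin

lemma right_mult_in_CGD: "right_mult x \<in> CGD sm"
proof -
  have "derivation sm (\<lambda>_. 0)"
    by (simp add: derivation_def clinear_map_def)
  moreover have "clinear_map sm (right_mult x)"
    by (simp add: clinear_map_def right_mult_def distrib_right scale_mult_left)
  ultimately have "generalized_derivation sm (right_mult x)"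
    unfolding generalized_derivation_def right_mult_def
    by (auto simp: mult.assoc intro!: exI[of _ "\<lambda>_. 0"])
  moreover have "centralizing (right_mult x)"
    using mult_right_commute
    by (simp add: centralizing_def center_def right_mult_def flip: mult.assoc)
  ultimately show ?thesis
    by (simp add: CGD_def)
qed

lemma right_mult_add: "(\<lambda>z. right_mult x z + right_mult y z) = right_mult (x + y)"
  and right_mult_scale: "(\<lambda>z. c *\<^sub>C right_mult x z) = right_mult (c *\<^sub>C x)"
  and right_mult_comp: "right_mult x \<circ> right_mult y = right_mult (x * y)"
  using mult_right_commute
  by (auto simp: right_mult_def fun_eq_iff distrib_left scale_mult_right simp flip: mult.assoc)

end

context comm_mod_radical_banach_algebra
begin

lemma CGD_eq_right_mult:
  assumes "\<delta> \<in> CGD sm"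
  shows "\<delta> = right_mult (\<delta> e)"
proof -
  obtain d where d: "derivation sm d" and \<delta>: "\<And>a b. \<delta> (a * b) = a * \<delta> b + d a * b"
    using assms by (auto simp: CGD_def generalized_derivation_def)
  interpret left_fixed_derivation e sm d
  proof
    show "e * d a = d a" for a
      using assms d \<delta> by (intro centralizing_derivation_left_id[of \<delta>])
        (auto simp: CGD_def derivation_def clinear_map_def)
  qed (rule d)
  show ?thesis
  proof
    show "\<delta> a = right_mult (\<delta> e) a" for a
      using \<delta>[of a e] by (simp add: right_mult_def derivation_eq_0)
  qed
qed

lemma CGD_eq_range_right_mult: "CGD sm = range right_mult"
  using CGD_eq_right_mult right_mult_in_CGD by blast

lemma CGD_closed:
  assumes "\<delta> \<in> CGD sm" and "\<gamma> \<in> CGD sm"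
  shows "(\<lambda>z. \<delta> z + \<gamma> z) \<in> CGD sm" and "(\<lambda>z. c *\<^sub>C \<delta> z) \<in> CGD sm" and "\<delta> \<circ> \<gamma> \<in> CGD sm"
  using assms unfolding CGD_eq_range_right_mult
  by (auto simp: right_mult_add right_mult_scale right_mult_comp)

lemma rcoset_eq_iff: "rcoset x = rcoset y \<longleftrightarrow> x - y \<in> (rann :: 'a set)"
proof
  assume "rcoset x = rcoset y"
  moreover have "x \<in> rcoset x"
    using subspace_0[OF subspace_rann] by (force simp: rcoset_def jrad_eq_rann)
  ultimately show "x - y \<in> rann"
    by (auto simp: rcoset_def jrad_eq_rann)
next
  have "rcoset x \<subseteq> rcoset y" if "x - y \<in> rann" for x y :: 'a
  proof
    fix z assume "z \<in> rcoset x"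
    then obtain r where "r \<in> rann" "z = y + (x - y + r)"
      by (auto simp: rcoset_def jrad_eq_rann)
    then show "z \<in> rcoset y"
      using subspace_add[OF subspace_rann that] unfolding rcoset_def jrad_eq_rann by blast
  qed
  moreover assume "x - y \<in> rann"
  moreover from this have "y - x \<in> rann"
    using subspace_neg[OF subspace_rann] by fastforce
  ultimately show "rcoset x = rcoset y" by blast
qed

lemma right_mult_eq_iff: "right_mult x = right_mult y \<longleftrightarrow> rcoset x = rcoset (y :: 'a)"
  by (auto simp: rcoset_eq_iff right_mult_def fun_eq_iff rann_def right_diff_distrib)

lemma rcoset_right_mult_id: "rcoset (right_mult x e) = rcoset x"
  using right_mult_eq_iff CGD_eq_right_mult[OF right_mult_in_CGD] by metis

lemma CGD_eq_right_mult_if_rcoset_eq: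
  assumes "\<delta> \<in> CGD sm" and "rcoset (\<delta> e) = rcoset x"
  shows "\<delta> = right_mult x"
  using CGD_eq_right_mult[OF assms(1)] assms(2) by (metis right_mult_eq_iff)

lemma bij_betw_CGD_rcosets: "bij_betw (\<lambda>\<delta>. rcoset (\<delta> e)) (CGD sm) (range rcoset)"
  unfolding CGD_eq_range_right_mult
  by (rule bij_betw_imageI)
    (auto simp: inj_on_def rcoset_right_mult_id right_mult_eq_iff image_image)

end

theorem theorem4p9:
  fixes sm :: "complex \<Rightarrow> 'a::{real_normed_algebra,banach} \<Rightarrow> 'a"
  assumes "complex_banach_algebra sm"
    and "(jrad :: 'a set) = rann"
    and "\<forall>a b :: 'a. a * b - b * a \<in> jrad"
    and "\<exists>e :: 'a. \<forall>a. a * e = a"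
  shows "CGD_iso_quotient sm"
proof -
  obtain e :: 'a where "\<And>a. a * e = a"
    using assms(4) by blast
  then interpret comm_mod_radical_banach_algebra e sm
    using assms(1-3) by unfold_locales auto
  define \<Phi> :: "('a \<Rightarrow> 'a) \<Rightarrow> 'a set" where "\<Phi> \<delta> = rcoset (\<delta> e)" for \<delta>
  have "\<forall>\<delta>\<in>CGD sm. \<forall>\<gamma>\<in>CGD sm. \<forall>c.
      (\<lambda>z. \<delta> z + \<gamma> z) \<in> CGD sm \<and> (\<lambda>z. sm c (\<delta> z)) \<in> CGD sm \<and> \<delta> \<circ> \<gamma> \<in> CGD sm"
    by (simp add: CGD_closed)
  moreover have "bij_betw \<Phi> (CGD sm) (range rcoset)"
    using bij_betw_CGD_rcosets by (simp add: \<Phi>_def[abs_def])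
  moreover have "\<Phi> (\<lambda>z. \<delta> z + \<gamma> z) = rcoset (x + y) \<and> \<Phi> (\<lambda>z. sm c (\<delta> z)) = rcoset (sm c x) \<and>
      \<Phi> (\<delta> \<circ> \<gamma>) = rcoset (x * y)"
    if "\<delta> \<in> CGD sm" "\<gamma> \<in> CGD sm" "\<Phi> \<delta> = rcoset x" "\<Phi> \<gamma> = rcoset y" for \<delta> \<gamma> x y c
  proof -
    have "\<delta> = right_mult x" "\<gamma> = right_mult y"
      using that CGD_eq_right_mult_if_rcoset_eq by (simp_all add: \<Phi>_def)
    then show ?thesis
      by (simp add: \<Phi>_def right_mult_add right_mult_scale right_mult_comp rcoset_right_mult_id)
  qed
  ultimately show ?thesis
    unfolding CGD_iso_quotient_def by blast
qed

end
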